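(* There exist a Hilbert space $H$ and positive operators $A,B\in\mathbb{B}(H)_+$ such that the equation $$A:B=X^*AX+(I-X)^*B(I-X),\quad X\in\mathbb{B}(H),$$ has no solution, where $A:B$ denotes the parallel sum of $A$ and $B$.
   Context: $\mathbb{B}(H)$ is the algebra of bounded linear operators on the Hilbert space $H$, and $\mathbb{B}(H)_+$ the set of its positive (i.e. positive semidefinite) elements. For $A,B\in\mathbb{B}(H)_+$ the parallel sum $A:B\in\mathbb{B}(H)_+$ is defined through the bilateral shorted operator of $\begin{pmatrix} A & A \\ A & A+B \end{pmatrix}$ on $H\oplus H$ with respect to $(H\oplus\{0\},H\oplus\{0\})$, which equals $\begin{pmatrix} A:B & 0 \\ 0 & 0 \end{pmatrix}$. Explicitly, $A:B=A-F^*F$, where $F\in\mathbb{B}(H)$ is the unique operator with $(A+B)^{1/2}F=A$ and $\mathcal{R}(F)\subseteq\overline{\mathcal{R}\big((A+B)^{1/2}\big)}$ ($\mathcal{R}$ denotes range, the bar norm closure). If $A$ and $B$ are both positive and invertible, then $A:B=A(A+B)^{-1}B=(A^{-1}+B^{-1})^{-1}$. *)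

theory Defs
  imports "HOL-Analysis.Analysis" "HOL-Algebra.Module"
begin

text \<open>
  Hilbert spaces are structures with an explicit carrier, so that statements can quantify over
  them.
\<close>

definition complex_field :: "complex ring" where
  "complex_field = \<lparr>carrier = UNIV, mult = (*), one = 1, zero = 0, add = (+)\<rparr>"

text \<open>
  Of the fields inherited from the module record, \<open>mult\<close> and \<open>one\<close> play no role for
  the underlying vector space.
\<close>

record 'a inner_space = "(complex, 'a) module" +
  cinner :: "'a \<Rightarrow> 'a \<Rightarrow> complex"

text \<open>The inner product is linear in its first and conjugate-linear in its second argument.\<close>

locale complex_inner_product_space =
  Module.module complex_field H for H :: "('a, 'm) inner_space_scheme" (structure) +
  assumes cinner_add_left:
      "\<lbrakk>x \<in> carrier H; y \<in> carrier H; z \<in> carrier H\<rbrakk> \<Longrightarrow>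
        cinner H (x \<oplus> y) z = cinner H x z + cinner H y z"
    and cinner_smult_left:
      "\<lbrakk>x \<in> carrier H; y \<in> carrier H\<rbrakk> \<Longrightarrow>
        cinner H (c \<odot> x) y = c * cinner H x y"
    and cinner_commute:
      "\<lbrakk>x \<in> carrier H; y \<in> carrier H\<rbrakk> \<Longrightarrow> cinner H y x = cnj (cinner H x y)"
    and cinner_nonneg: "x \<in> carrier H \<Longrightarrow> cinner H x x \<in> \<real>\<^sub>\<ge>\<^sub>0"
    and cinner_definite: "\<lbrakk>x \<in> carrier H; cinner H x x = 0\<rbrakk> \<Longrightarrow> x = \<zero>"

definition hnorm :: "('a, 'm) inner_space_scheme \<Rightarrow> 'a \<Rightarrow> real" where
  "hnorm H x = sqrt (Re (cinner H x x))"

text \<open>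
  The locale \<open>Metric_space\<close> wants a distance that is nonnegative and symmetric also outside
  the carrier, hence the case distinction.
\<close>

definition hdist :: "('a, 'm) inner_space_scheme \<Rightarrow> 'a \<Rightarrow> 'a \<Rightarrow> real" where
  "hdist H x y =
     (if x \<in> carrier H \<and> y \<in> carrier H then hnorm H (x \<ominus>\<^bsub>H\<^esub> y) else 0)"

locale hilbert_space = complex_inner_product_space +
  assumes complete: "Metric_space.mcomplete (carrier H) (hdist H)"

definition norm_closure :: "('a, 'm) inner_space_scheme \<Rightarrow> 'a set \<Rightarrow> 'a set" where
  "norm_closure H S = Metric_space.mtopology (carrier H) (hdist H) closure_of S"

text \<open>
  Operators are extensional functions (\<open>undefined\<close> outside the carrier), so that equality of
  operators is equality of functions.
\<close>

definition bounded_operators :: "('a, 'm) inner_space_scheme \<Rightarrow> ('a \<Rightarrow> 'a) set" where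
  "bounded_operators H =
     {T \<in> carrier H \<rightarrow>\<^sub>E carrier H.
        (\<forall>x\<in>carrier H. \<forall>y\<in>carrier H. T (x \<oplus>\<^bsub>H\<^esub> y) = T x \<oplus>\<^bsub>H\<^esub> T y) \<and>
        (\<forall>c. \<forall>x\<in>carrier H. T (c \<odot>\<^bsub>H\<^esub> x) = c \<odot>\<^bsub>H\<^esub> T x) \<and>
        (\<exists>K. \<forall>x\<in>carrier H. hnorm H (T x) \<le> K * hnorm H x)}"

definition \<BB> :: "('a, 'm) inner_space_scheme \<Rightarrow> ('a \<Rightarrow> 'a) ring" where
  "\<BB> H =
     \<lparr>carrier = bounded_operators H,
      mult = compose (carrier H),
      one = (\<lambda>x\<in>carrier H. x),
      zero = (\<lambda>x\<in>carrier H. \<zero>\<^bsub>H\<^esub>),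
      add = (\<lambda>S T. \<lambda>x\<in>carrier H. S x \<oplus>\<^bsub>H\<^esub> T x)\<rparr>"

definition adjoint_op :: "('a, 'm) inner_space_scheme \<Rightarrow> ('a \<Rightarrow> 'a) \<Rightarrow> 'a \<Rightarrow> 'a" where
  "adjoint_op H T =
     (THE S. S \<in> carrier (\<BB> H) \<and>
        (\<forall>x\<in>carrier H. \<forall>y\<in>carrier H. cinner H (T x) y = cinner H x (S y)))"

definition positive_operators :: "('a, 'm) inner_space_scheme \<Rightarrow> ('a \<Rightarrow> 'a) set" where
  "positive_operators H =
     {T \<in> carrier (\<BB> H). \<forall>x\<in>carrier H. cinner H (T x) x \<in> \<real>\<^sub>\<ge>\<^sub>0}"

definition sqrt_op :: "('a, 'm) inner_space_scheme \<Rightarrow> ('a \<Rightarrow> 'a) \<Rightarrow> 'a \<Rightarrow> 'a" where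
  "sqrt_op H T = (THE S. S \<in> positive_operators H \<and> S \<otimes>\<^bsub>\<BB> H\<^esub> S = T)"

text \<open>
  The operator \<open>F\<close> with \<open>(A + B)\<^sup>1\<^sup>/\<^sup>2 F = A\<close> whose range lies in the closure of the range of
  \<open>(A + B)\<^sup>1\<^sup>/\<^sup>2\<close>; it exists by Douglas' theorem when \<open>A\<close> and \<open>B\<close> are positive.
\<close>

definition parallel_factor ::
  "('a, 'm) inner_space_scheme \<Rightarrow> ('a \<Rightarrow> 'a) \<Rightarrow> ('a \<Rightarrow> 'a) \<Rightarrow> 'a \<Rightarrow> 'a" where
  "parallel_factor H A B =
     (let R = sqrt_op H (A \<oplus>\<^bsub>\<BB> H\<^esub> B) in
      THE F. F \<in> carrier (\<BB> H) \<and> R \<otimes>\<^bsub>\<BB> H\<^esub> F = A \<and>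
        F ` carrier H \<subseteq> norm_closure H (R ` carrier H))"

definition parallel_sum ::
  "('a, 'm) inner_space_scheme \<Rightarrow> ('a \<Rightarrow> 'a) \<Rightarrow> ('a \<Rightarrow> 'a) \<Rightarrow> 'a \<Rightarrow> 'a" where
  "parallel_sum H A B =
     (let F = parallel_factor H A B in A \<ominus>\<^bsub>\<BB> H\<^esub> (adjoint_op H F \<otimes>\<^bsub>\<BB> H\<^esub> F))"

end

theory Submission
  imports Defs
begin

text \<open>
  On the space of square summable sequences let \<open>D\<close> be multiplication by a sequence \<open>c\<close> with values
  in \<open>(0, 1]\<close> and let \<open>U\<close> be the unitary involution induced by swapping the indices \<open>2k\<close> and \<open>2k + 1\<close>.
  Put \<open>A = D (1 + U) D / 2\<close> and \<open>B = D (1 - U) D / 2\<close>. Then \<open>A + B = D\<^sup>2\<close>, the factor of the parallel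
  sum is \<open>F = (1 + U) D / 2\<close>, and \<open>F\<^sup>* F = A\<close>, so that \<open>A : B = 0\<close>. A solution \<open>X\<close> therefore
  satisfies \<open>A X = 0\<close> and \<open>B (1 - X) = 0\<close>, whence \<open>D (1 - 2 X) = U D\<close>. This fails as soon as
  the range of \<open>U D\<close> is not contained in the range of \<open>D\<close>, for instance for \<open>c i = 1\<close> at even and
  \<open>c i = 1 / (i + 1)\<close> at odd indices.
\<close>

section \<open>Complex inner product spaces and their operators\<close>

lemma carrier_complex_field [simp]: "carrier complex_field = UNIV"
  and mult_complex_field [simp]: "x \<otimes>\<^bsub>complex_field\<^esub> y = x * y"
  and one_complex_field [simp]: "\<one>\<^bsub>complex_field\<^esub> = 1"
  and zero_complex_field [simp]: "\<zero>\<^bsub>complex_field\<^esub> = 0"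
  and add_complex_field [simp]: "x \<oplus>\<^bsub>complex_field\<^esub> y = x + y"
  by (simp_all add: complex_field_def)

lemma cring_complex_field: "cring complex_field"
proof (rule cringI)
  show "abelian_group complex_field"
    by (rule abelian_groupI) (auto intro: exI[of _ "- _"] simp: algebra_simps add_eq_0_iff)
  show "comm_monoid complex_field"
    by unfold_locales (auto simp: algebra_simps)
qed (auto simp: algebra_simps)

section \<open>Norm, Cauchy-Schwarz inequality and metric of an inner product space\<close>

context complex_inner_product_space
begin

lemma smult_mem [simp]: "x \<in> carrier H \<Longrightarrow> c \<odot> x \<in> carrier H"
  by (simp add: smult_closed)

lemma cinner_add_right:
  assumes "x \<in> carrier H" "y \<in> carrier H" "z \<in> carrier H"
  shows "cinner H x (y \<oplus> z) = cinner H x y + cinner H x z"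
  using assms by (simp add: cinner_add_left cinner_commute[of _ x])

lemma cinner_smult_right:
  assumes "x \<in> carrier H" "y \<in> carrier H"
  shows "cinner H x (c \<odot> y) = cnj c * cinner H x y"
  using assms by (simp add: cinner_smult_left cinner_commute[of _ x])

lemma cinner_minus_left:
  assumes "x \<in> carrier H" "y \<in> carrier H" "z \<in> carrier H"
  shows "cinner H (x \<ominus> y) z = cinner H x z - cinner H y z"
proof -
  have "x \<ominus> y \<oplus> y = x"
    using assms by (simp add: a_minus_def a_assoc l_neg)
  then show ?thesis
    using assms cinner_add_left[of "x \<ominus> y" y z] by simp
qed

lemma cinner_minus_right:
  assumes "x \<in> carrier H" "y \<in> carrier H" "z \<in> carrier H"
  shows "cinner H x (y \<ominus> z) = cinner H x y - cinner H x z"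
  using assms by (simp add: cinner_minus_left cinner_commute[of _ x])

lemma cinner_zero_left [simp]: "x \<in> carrier H \<Longrightarrow> cinner H \<zero> x = 0"
  using cinner_add_left[of "\<zero>" "\<zero>" x] by simp

lemma cinner_zero_right [simp]: "x \<in> carrier H \<Longrightarrow> cinner H x \<zero> = 0"
  using cinner_add_right[of x "\<zero>" "\<zero>"] by simp

lemma hnorm_nonneg [simp]: "x \<in> carrier H \<Longrightarrow> 0 \<le> hnorm H x"
  using cinner_nonneg[of x] by (simp add: hnorm_def complex_nonneg_Reals_iff)

lemma cinner_self: "x \<in> carrier H \<Longrightarrow> cinner H x x = of_real ((hnorm H x)\<^sup>2)"
  using cinner_nonneg[of x] by (auto simp: hnorm_def complex_nonneg_Reals_iff complex_eq_iff)

lemma hnorm_zero [simp]: "hnorm H \<zero> = 0"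
  by (simp add: hnorm_def)

lemma hnorm_eq_0_iff [simp]:
  assumes "x \<in> carrier H"
  shows "hnorm H x = 0 \<longleftrightarrow> x = \<zero>"
  using assms cinner_definite[of x] cinner_self[of x] by auto

lemma hnorm_add_sq:
  assumes "x \<in> carrier H" "y \<in> carrier H"
  shows "(hnorm H (x \<oplus> y))\<^sup>2 = (hnorm H x)\<^sup>2 + 2 * Re (cinner H x y) + (hnorm H y)\<^sup>2"
proof -
  have "complex_of_real ((hnorm H (x \<oplus> y))\<^sup>2) = cinner H (x \<oplus> y) (x \<oplus> y)"
    using assms by (simp only: cinner_self add.m_closed)
  also have "\<dots> = cinner H x x + (cinner H x y + cnj (cinner H x y)) + cinner H y y"
    using assms by (simp add: cinner_add_left cinner_add_right cinner_commute[of x y])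
  also have "\<dots> = of_real ((hnorm H x)\<^sup>2 + 2 * Re (cinner H x y) + (hnorm H y)\<^sup>2)"
    using assms by (simp add: cinner_self complex_add_cnj)
  finally show ?thesis
    by (simp only: of_real_eq_iff)
qed

lemma hnorm_smult:
  assumes "x \<in> carrier H"
  shows "hnorm H (c \<odot> x) = cmod c * hnorm H x"
proof -
  have "complex_of_real ((hnorm H (c \<odot> x))\<^sup>2) = cinner H (c \<odot> x) (c \<odot> x)"
    using assms by (simp only: cinner_self smult_mem)
  also have "\<dots> = c * cnj c * cinner H x x"
    using assms by (simp add: cinner_smult_left cinner_smult_right)
  also have "\<dots> = of_real ((cmod c * hnorm H x)\<^sup>2)"
    using assms by (simp only: cinner_self complex_norm_square power_mult_distrib of_real_mult)
  finally have "(hnorm H (c \<odot> x))\<^sup>2 = (cmod c * hnorm H x)\<^sup>2"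
    by (simp only: of_real_eq_iff)
  then show ?thesis
    using assms by (simp add: power2_eq_iff_nonneg)
qed

lemma Cauchy_Schwarz:
  assumes x: "x \<in> carrier H" and y: "y \<in> carrier H"
  shows "cmod (cinner H x y) \<le> hnorm H x * hnorm H y"
proof (cases "y = \<zero>")
  case False
  define n where "n = hnorm H y"
  have n: "n > 0"
    using False y hnorm_nonneg[OF y] hnorm_eq_0_iff[OF y] by (simp add: n_def less_le)
  \<comment> \<open>This makes \<open>x \<oplus> c \<odot> y\<close> orthogonal to \<open>y\<close>,
    so its squared norm is that of \<open>x\<close> minus |<x,y>|^2 / n^2; nonnegativity is then the
    claim.\<close>
  define c where "c = - cinner H x y / of_real (n\<^sup>2)"
  have "0 \<le> (hnorm H (x \<oplus> c \<odot> y))\<^sup>2"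
    by simp
  also have "\<dots> = (hnorm H x)\<^sup>2 + 2 * Re (cnj c * cinner H x y) + (cmod c)\<^sup>2 * n\<^sup>2"
    using x y by (simp add: hnorm_add_sq hnorm_smult cinner_smult_right power_mult_distrib n_def)
  also have "cnj c * cinner H x y = of_real (- (cmod (cinner H x y))\<^sup>2 / n\<^sup>2)"
    by (simp add: c_def complex_norm_square mult_ac del: of_real_power)
  also have "cmod c = cmod (cinner H x y) / n\<^sup>2"
    using n by (simp add: c_def norm_divide norm_power)
  also have "(cmod (cinner H x y) / n\<^sup>2)\<^sup>2 * n\<^sup>2 = (cmod (cinner H x y))\<^sup>2 / n\<^sup>2"
    using n by (simp add: power2_eq_square)
  finally have "(cmod (cinner H x y))\<^sup>2 / n\<^sup>2 \<le> (hnorm H x)\<^sup>2"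
    by (simp del: of_real_power of_real_divide)
  then have "(cmod (cinner H x y))\<^sup>2 \<le> (hnorm H x * n)\<^sup>2"
    using n by (simp add: field_simps power_mult_distrib)
  then show ?thesis
    using x y power2_le_imp_le[of "cmod (cinner H x y)" "hnorm H x * hnorm H y"] by (simp add: n_def)
qed (use x in simp)

lemma hnorm_triangle:
  assumes "x \<in> carrier H" "y \<in> carrier H"
  shows "hnorm H (x \<oplus> y) \<le> hnorm H x + hnorm H y"
proof (rule power2_le_imp_le)
  have "Re (cinner H x y) \<le> hnorm H x * hnorm H y"
    using Cauchy_Schwarz[OF assms] complex_Re_le_cmod order_trans by blast
  then show "(hnorm H (x \<oplus> y))\<^sup>2 \<le> (hnorm H x + hnorm H y)\<^sup>2"
    using assms by (simp add: hnorm_add_sq power2_sum)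
qed (use assms in simp)

text \<open>Reduces negation to scalar multiplication, so that homogeneity of the norm and of
  operators also covers differences.\<close>

lemma minus_eq_smult: "x \<in> carrier H \<Longrightarrow> \<ominus> x = (- 1) \<odot> x"
  using smult_l_distr[of "- 1" 1 x] smult_one[of x] smult_l_null[of x]
  by (simp add: minus_equality)

lemma hnorm_uminus [simp]: "x \<in> carrier H \<Longrightarrow> hnorm H (\<ominus> x) = hnorm H x"
  by (simp add: minus_eq_smult hnorm_smult)

lemma minus_eq_zero_iff:
  assumes "x \<in> carrier H" "y \<in> carrier H"
  shows "x \<ominus> y = \<zero> \<longleftrightarrow> x = y"
  using assms by (metis a_minus_def add.inv_closed minus_equality minus_minus r_neg)

lemma Metric_space_hdist: "Metric_space (carrier H) (hdist H)"
proof
  show "0 \<le> hdist H x y" for x y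
    by (simp add: hdist_def)
  show "hdist H x y = hdist H y x" for x y
  proof (cases "x \<in> carrier H \<and> y \<in> carrier H")
    case True
    then have "y \<ominus> x = \<ominus> (x \<ominus> y)"
      by (simp add: a_minus_def minus_add a_comm)
    with True show ?thesis
      by (simp add: hdist_def)
  qed (auto simp: hdist_def)
  show "hdist H x y = 0 \<longleftrightarrow> x = y" if "x \<in> carrier H" "y \<in> carrier H" for x y
    using that by (simp add: hdist_def minus_eq_zero_iff)
  show "hdist H x z \<le> hdist H x y + hdist H y z"
    if "x \<in> carrier H" "y \<in> carrier H" "z \<in> carrier H" for x y z
  proof -
    have "\<ominus> y \<oplus> (y \<oplus> \<ominus> z) = \<ominus> z"
      using that r_neg1 by simp
    then have "x \<ominus> z = (x \<ominus> y) \<oplus> (y \<ominus> z)"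
      using that by (simp add: a_minus_def a_assoc)
    then show ?thesis
      using that hnorm_triangle[of "x \<ominus> y" "y \<ominus> z"] by (simp add: hdist_def)
  qed
qed

text \<open>Testing with the difference \<open>y \<ominus> z\<close> itself gives it norm zero, and
  definiteness applies.\<close>

lemma cinner_eqI:
  assumes "y \<in> carrier H" "z \<in> carrier H"
    and "\<And>x. x \<in> carrier H \<Longrightarrow> cinner H x y = cinner H x z"
  shows "y = z"
proof -
  have "cinner H (y \<ominus> z) (y \<ominus> z) = 0"
    using assms by (simp add: cinner_minus_right)
  then show ?thesis
    using assms(1,2) cinner_definite[of "y \<ominus> z"] minus_eq_zero_iff[of y z] by simp
qed

section \<open>Bounded operators: pointwise rules, products, and the additive group\<close>

lemma bounded_operatorI:
  assumes "T \<in> carrier H \<rightarrow>\<^sub>E carrier H"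
    and "\<And>x y. x \<in> carrier H \<Longrightarrow> y \<in> carrier H \<Longrightarrow> T (x \<oplus> y) = T x \<oplus> T y"
    and "\<And>c x. x \<in> carrier H \<Longrightarrow> T (c \<odot> x) = c \<odot> T x"
    and "\<And>x. x \<in> carrier H \<Longrightarrow> hnorm H (T x) \<le> K * hnorm H x"
  shows "T \<in> carrier (\<BB> H)"
proof -
  have "\<exists>K. \<forall>x\<in>carrier H. hnorm H (T x) \<le> K * hnorm H x"
    using assms(4) by (intro exI[of _ K] ballI)
  with assms(1-3) show ?thesis
    by (simp add: \<BB>_def bounded_operators_def)
qed

lemma op_mem [simp]: "T \<in> carrier (\<BB> H) \<Longrightarrow> x \<in> carrier H \<Longrightarrow> T x \<in> carrier H"
  and op_PiE: "T \<in> carrier (\<BB> H) \<Longrightarrow> T \<in> carrier H \<rightarrow>\<^sub>E carrier H"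
  and op_add: "T \<in> carrier (\<BB> H) \<Longrightarrow> x \<in> carrier H \<Longrightarrow> y \<in> carrier H \<Longrightarrow> T (x \<oplus> y) = T x \<oplus> T y"
  and op_smult: "T \<in> carrier (\<BB> H) \<Longrightarrow> x \<in> carrier H \<Longrightarrow> T (c \<odot> x) = c \<odot> T x"
  unfolding \<BB>_def bounded_operators_def by auto

lemma op_zero [simp]:
  assumes "T \<in> carrier (\<BB> H)"
  shows "T \<zero> = \<zero>"
  using op_smult[OF assms, of "\<zero>" 0] assms by (metis op_mem smult_l_null zero_closed zero_complex_field)

lemma op_minus:
  assumes "T \<in> carrier (\<BB> H)" "x \<in> carrier H" "y \<in> carrier H"
  shows "T (x \<ominus> y) = T x \<ominus> T y"
  using assms by (simp add: a_minus_def minus_eq_smult op_add op_smult)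

text \<open>The definition admits any real bound. A nonnegative one is needed to chain estimates
  through products and adjoints.\<close>

lemma op_bounded:
  assumes "T \<in> carrier (\<BB> H)"
  shows "\<exists>K\<ge>0. \<forall>x\<in>carrier H. hnorm H (T x) \<le> K * hnorm H x"
proof -
  have "\<exists>K. \<forall>x\<in>carrier H. hnorm H (T x) \<le> K * hnorm H x"
    using assms by (simp add: \<BB>_def bounded_operators_def)
  then obtain K where K: "\<And>x. x \<in> carrier H \<Longrightarrow> hnorm H (T x) \<le> K * hnorm H x"
    by blast
  have "hnorm H (T x) \<le> max K 0 * hnorm H x" if "x \<in> carrier H" for x
    using K[OF that] that by (meson hnorm_nonneg max.cobounded1 mult_right_mono order_trans)
  then show ?thesis
    by (intro exI[of _ "max K 0"]) simp
qed

lemma op_eqI: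
  assumes "S \<in> carrier (\<BB> H)" "T \<in> carrier (\<BB> H)" "\<And>x. x \<in> carrier H \<Longrightarrow> S x = T x"
  shows "S = T"
  using assms op_PiE PiE_ext by metis

lemma mult_op_apply: "x \<in> carrier H \<Longrightarrow> (S \<otimes>\<^bsub>\<BB> H\<^esub> T) x = S (T x)"
  and one_op_apply: "x \<in> carrier H \<Longrightarrow> \<one>\<^bsub>\<BB> H\<^esub> x = x"
  and zero_op_apply: "x \<in> carrier H \<Longrightarrow> \<zero>\<^bsub>\<BB> H\<^esub> x = \<zero>"
  and add_op_apply: "x \<in> carrier H \<Longrightarrow> (S \<oplus>\<^bsub>\<BB> H\<^esub> T) x = S x \<oplus> T x"
  by (simp_all add: \<BB>_def compose_def)

lemma one_op_mem: "\<one>\<^bsub>\<BB> H\<^esub> \<in> carrier (\<BB> H)"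
  by (rule bounded_operatorI[where K = 1]) (auto simp: \<BB>_def)

lemma mult_op_mem:
  assumes S: "S \<in> carrier (\<BB> H)" and T: "T \<in> carrier (\<BB> H)"
  shows "S \<otimes>\<^bsub>\<BB> H\<^esub> T \<in> carrier (\<BB> H)"
proof -
  obtain K where K: "K \<ge> 0" "\<And>x. x \<in> carrier H \<Longrightarrow> hnorm H (S x) \<le> K * hnorm H x"
    using op_bounded[OF S] by metis
  obtain L where L: "L \<ge> 0" "\<And>x. x \<in> carrier H \<Longrightarrow> hnorm H (T x) \<le> L * hnorm H x"
    using op_bounded[OF T] by metis
  show ?thesis
  proof (rule bounded_operatorI[where K = "K * L"])
    have "S \<otimes>\<^bsub>\<BB> H\<^esub> T = (\<lambda>x\<in>carrier H. S (T x))"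
      by (simp add: \<BB>_def compose_def)
    then show "S \<otimes>\<^bsub>\<BB> H\<^esub> T \<in> carrier H \<rightarrow>\<^sub>E carrier H"
      using S T by simp
    show "hnorm H ((S \<otimes>\<^bsub>\<BB> H\<^esub> T) x) \<le> K * L * hnorm H x" if "x \<in> carrier H" for x
      using K(2)[of "T x"] mult_left_mono[OF L(2)[OF that] K(1)] that T
      by (simp add: mult_op_apply mult.assoc)
  qed (use S T in \<open>simp_all add: mult_op_apply op_add op_smult\<close>)
qed

lemma add_op_mem:
  assumes S: "S \<in> carrier (\<BB> H)" and T: "T \<in> carrier (\<BB> H)"
  shows "S \<oplus>\<^bsub>\<BB> H\<^esub> T \<in> carrier (\<BB> H)"
proof -
  obtain K where K: "\<And>x. x \<in> carrier H \<Longrightarrow> hnorm H (S x) \<le> K * hnorm H x"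
    using op_bounded[OF S] by metis
  obtain L where L: "\<And>x. x \<in> carrier H \<Longrightarrow> hnorm H (T x) \<le> L * hnorm H x"
    using op_bounded[OF T] by metis
  show ?thesis
  proof (rule bounded_operatorI[where K = "K + L"])
    have "S \<oplus>\<^bsub>\<BB> H\<^esub> T = (\<lambda>x\<in>carrier H. S x \<oplus> T x)"
      by (simp add: \<BB>_def)
    then show "S \<oplus>\<^bsub>\<BB> H\<^esub> T \<in> carrier H \<rightarrow>\<^sub>E carrier H"
      using S T by simp
    show "hnorm H ((S \<oplus>\<^bsub>\<BB> H\<^esub> T) x) \<le> (K + L) * hnorm H x" if "x \<in> carrier H" for x
      using hnorm_triangle[of "S x" "T x"] K[OF that] L[OF that] S T that
      by (simp add: add_op_apply distrib_right)
  next
    fix x y assume "x \<in> carrier H" "y \<in> carrier H"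
    then show "(S \<oplus>\<^bsub>\<BB> H\<^esub> T) (x \<oplus> y) = (S \<oplus>\<^bsub>\<BB> H\<^esub> T) x \<oplus> (S \<oplus>\<^bsub>\<BB> H\<^esub> T) y"
      using S T by (simp add: add_op_apply op_add a_ac)
  qed (use S T in \<open>simp_all add: add_op_apply op_smult smult_r_distr\<close>)
qed

text \<open>Subtraction in \<open>\<BB> H\<close> goes through the abstract additive inverse, a
  definite description; it can be evaluated only once the group laws are known.\<close>

lemma abelian_group_BB: "abelian_group (\<BB> H)"
proof (rule abelian_groupI)
  show zero: "\<zero>\<^bsub>\<BB> H\<^esub> \<in> carrier (\<BB> H)"
    by (rule bounded_operatorI[where K = 0])
      (auto simp: \<BB>_def smult_r_null)
  fix S assume S: "S \<in> carrier (\<BB> H)"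
  show "\<zero>\<^bsub>\<BB> H\<^esub> \<oplus>\<^bsub>\<BB> H\<^esub> S = S"
    using S zero by (intro op_eqI add_op_mem) (simp_all add: add_op_apply zero_op_apply)
  define N where "N = (\<lambda>x\<in>carrier H. \<ominus> S x)"
  obtain K where K: "\<And>x. x \<in> carrier H \<Longrightarrow> hnorm H (S x) \<le> K * hnorm H x"
    using op_bounded[OF S] by metis
  have N: "N \<in> carrier (\<BB> H)"
  proof (rule bounded_operatorI[where K = K])
    show "N (c \<odot> x) = c \<odot> N x" if "x \<in> carrier H" for c x
      using that S by (simp add: N_def op_smult smult_r_minus)
  qed (use S K in \<open>auto simp: N_def op_add minus_add a_comm\<close>)
  have "N \<oplus>\<^bsub>\<BB> H\<^esub> S = \<zero>\<^bsub>\<BB> H\<^esub>"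
    using S N zero by (intro op_eqI add_op_mem) (simp_all add: add_op_apply zero_op_apply N_def l_neg)
  with N show "\<exists>T\<in>carrier (\<BB> H). T \<oplus>\<^bsub>\<BB> H\<^esub> S = \<zero>\<^bsub>\<BB> H\<^esub>"
    by blast
  fix T assume T: "T \<in> carrier (\<BB> H)"
  show "S \<oplus>\<^bsub>\<BB> H\<^esub> T \<in> carrier (\<BB> H)"
    using S T by (rule add_op_mem)
  show "S \<oplus>\<^bsub>\<BB> H\<^esub> T = T \<oplus>\<^bsub>\<BB> H\<^esub> S"
    using S T by (intro op_eqI add_op_mem) (simp_all add: add_op_apply a_comm)
  fix U assume U: "U \<in> carrier (\<BB> H)"
  show "S \<oplus>\<^bsub>\<BB> H\<^esub> T \<oplus>\<^bsub>\<BB> H\<^esub> U = S \<oplus>\<^bsub>\<BB> H\<^esub> (T \<oplus>\<^bsub>\<BB> H\<^esub> U)"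
    using S T U by (intro op_eqI add_op_mem) (simp_all add: add_op_apply a_assoc)
qed

lemma minus_op_mem: "S \<in> carrier (\<BB> H) \<Longrightarrow> T \<in> carrier (\<BB> H) \<Longrightarrow> S \<ominus>\<^bsub>\<BB> H\<^esub> T \<in> carrier (\<BB> H)"
  by (rule abelian_group.minus_closed[OF abelian_group_BB])

text \<open>Evaluating (S - T) + T = S at \<open>x\<close> and cancelling \<open>T x\<close> avoids
  any explicit description of the inverse operator.\<close>

lemma minus_op_apply:
  assumes "S \<in> carrier (\<BB> H)" "T \<in> carrier (\<BB> H)" "x \<in> carrier H"
  shows "(S \<ominus>\<^bsub>\<BB> H\<^esub> T) x = S x \<ominus> T x"
proof -
  interpret BB: abelian_group "\<BB> H"
    by (rule abelian_group_BB)
  have "(S \<ominus>\<^bsub>\<BB> H\<^esub> T) \<oplus>\<^bsub>\<BB> H\<^esub> T = S"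
    using assms by (simp add: a_minus_def BB.a_assoc BB.l_neg)
  then have "(S \<ominus>\<^bsub>\<BB> H\<^esub> T) x \<oplus> T x = S x"
    using assms add_op_apply by metis
  moreover have "(S \<ominus>\<^bsub>\<BB> H\<^esub> T) x \<in> carrier H"
    using assms by (simp add: minus_op_mem)
  ultimately show ?thesis
    using assms by (metis a_minus_def a_assoc a_inv_closed op_mem r_neg r_zero)
qed

section \<open>Uniqueness of adjoints, and positive operators\<close>

lemma adjoint_op_eqI:
  assumes S: "S \<in> carrier (\<BB> H)"
    and adj: "\<And>x y. x \<in> carrier H \<Longrightarrow> y \<in> carrier H \<Longrightarrow> cinner H (T x) y = cinner H x (S y)"
  shows "adjoint_op H T = S"
  unfolding adjoint_op_def
proof (rule the_equality)
  \<comment> \<open>\<open>adjoint_op\<close> is a definite description, so a rival candidate must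
    be excluded: at each point it has the same inner products as \<open>S\<close> with every
    vector.\<close>
  fix S' assume "S' \<in> carrier (\<BB> H) \<and>
    (\<forall>x\<in>carrier H. \<forall>y\<in>carrier H. cinner H (T x) y = cinner H x (S' y))"
  then show "S' = S"
    using assms by (intro op_eqI) (auto intro!: cinner_eqI)
qed (use assms in simp)

lemma positive_opD:
  assumes "T \<in> positive_operators H"
  shows "T \<in> carrier (\<BB> H)" "\<And>x. x \<in> carrier H \<Longrightarrow> cinner H (T x) x \<in> \<real>\<^sub>\<ge>\<^sub>0"
  using assms by (simp_all add: positive_operators_def)

text \<open>Polarisation: the quadratic form of \<open>T\<close> is real at \<open>x\<close>, at
  \<open>y\<close> and at every x + c y, so the cross terms have vanishing imaginary part for each
  scalar \<open>c\<close>.\<close>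

lemma positive_op_selfadjoint:
  assumes T: "T \<in> positive_operators H" and x: "x \<in> carrier H" and y: "y \<in> carrier H"
  shows "cinner H (T x) y = cinner H x (T y)"
proof -
  note T' = positive_opD[OF T]
  define u where "u = cinner H (T x) y"
  define v where "v = cinner H (T y) x"
  have im: "Im (cinner H (T z) z) = 0" if "z \<in> carrier H" for z
    using T'(2)[OF that] by (simp add: complex_nonneg_Reals_iff)
  have "Im (cnj c * u + c * v) = 0" for c
  proof -
    have "cinner H (T (x \<oplus> c \<odot> y)) (x \<oplus> c \<odot> y)
        = cinner H (T x) x + (cnj c * u + c * v) + c * cnj c * cinner H (T y) y"
      using T' x y by (simp add: op_add op_smult cinner_add_left cinner_add_right
          cinner_smult_left cinner_smult_right u_def v_def algebra_simps)
    then have "Im (cinner H (T x) x + (cnj c * u + c * v) + c * cnj c * cinner H (T y) y) = 0"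
      using im[of "x \<oplus> c \<odot> y"] x y by simp
    then show ?thesis
      using im[OF x] im[OF y] by simp
  qed
  \<comment> \<open>The value 1 yields Im u = - Im v, and the imaginary unit yields Re u = Re
    v.\<close>
  from this[of 1] this[of \<i>] have "u = cnj v"
    by (simp add: complex_eq_iff)
  then show ?thesis
    using T' x y by (simp add: u_def v_def cinner_commute[of x "T y"])
qed

text \<open>\<open>(S + r)(S - r)\<close> annihilates \<open>e\<close>, and \<open>S + r\<close> is injective because \<open>S\<close> is positive.\<close>

lemma positive_op_eigenvector:
  assumes S: "S \<in> positive_operators H" and e: "e \<in> carrier H" and r: "0 < r"
    and SS: "S (S e) = of_real (r\<^sup>2) \<odot> e"
  shows "S e = of_real r \<odot> e"
proof -
  note S' = positive_opD[OF S]
  define y where "y = S e \<ominus> of_real r \<odot> e"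
  have y: "y \<in> carrier H"
    using S' e by (simp add: y_def)
  have "S y = of_real (r\<^sup>2) \<odot> e \<ominus> of_real r \<odot> S e"
    using S' e by (simp add: y_def op_minus op_smult SS)
  then have "cinner H (S y) y = - of_real r * cinner H y y"
    using S' e y
    by (simp add: y_def[symmetric] cinner_minus_left cinner_smult_left)
      (simp add: y_def cinner_minus_left cinner_minus_right cinner_smult_left cinner_smult_right
        algebra_simps power2_eq_square)
  then have "0 \<le> - (r * (hnorm H y)\<^sup>2)"
    using S'(2)[OF y] y by (simp add: cinner_self complex_nonneg_Reals_iff)
  then have "(hnorm H y)\<^sup>2 \<le> 0"
    using r by (simp add: mult_le_0_iff)
  then show ?thesis
    using y S' e by (simp add: y_def minus_eq_zero_iff)
qed

end

section \<open>Square summable families\<close>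

definition ell2 :: "('i \<Rightarrow> complex) inner_space" where
  "ell2 = \<lparr>carrier = {x. (\<lambda>i. (cmod (x i))\<^sup>2) summable_on UNIV},
     mult = (\<lambda>x y i. x i * y i), one = (\<lambda>i. 1), zero = (\<lambda>i. 0), add = (\<lambda>x y i. x i + y i),
     smult = (\<lambda>c x i. c * x i), cinner = (\<lambda>x y. \<Sum>\<^sub>\<infinity>i. x i * cnj (y i))\<rparr>"

lemma zero_ell2 [simp]: "\<zero>\<^bsub>ell2\<^esub> = (\<lambda>i. 0)"
  and add_ell2 [simp]: "x \<oplus>\<^bsub>ell2\<^esub> y = (\<lambda>i. x i + y i)"
  and smult_ell2 [simp]: "c \<odot>\<^bsub>ell2\<^esub> x = (\<lambda>i. c * x i)"
  by (simp_all add: ell2_def)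

lemma mem_ell2_iff: "x \<in> carrier ell2 \<longleftrightarrow> (\<lambda>i. (cmod (x i))\<^sup>2) summable_on UNIV"
  and cinner_ell2: "cinner ell2 x y = (\<Sum>\<^sub>\<infinity>i. x i * cnj (y i))"
  by (simp_all add: ell2_def)

text \<open>Comparison with 2 |a|^2 + 2 |b|^2, which dominates |a + b|^2 because (|a| - |b|)^2 is
  nonnegative.\<close>

lemma ell2_add_mem:
  assumes "x \<in> carrier ell2" "y \<in> carrier ell2"
  shows "(\<lambda>i. x i + y i) \<in> carrier ell2"
proof -
  have "(cmod (x i + y i))\<^sup>2 \<le> 2 * (cmod (x i))\<^sup>2 + 2 * (cmod (y i))\<^sup>2" for i
    using power_mono[OF norm_triangle_ineq[of "x i" "y i"], of 2]
      zero_le_power2[of "cmod (x i) - cmod (y i)"]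
    by (simp add: power2_sum power2_diff)
  moreover have "(\<lambda>i. 2 * (cmod (x i))\<^sup>2 + 2 * (cmod (y i))\<^sup>2) summable_on UNIV"
    using assms by (intro summable_on_add summable_on_cmult_right) (simp_all add: mem_ell2_iff)
  ultimately show ?thesis
    unfolding mem_ell2_iff by - (rule summable_on_comparison_test, assumption, simp_all)
qed

lemma ell2_bounded_mult_mem:
  assumes "x \<in> carrier ell2" "\<And>i. cmod (c i) \<le> K"
  shows "(\<lambda>i. c i * x i) \<in> carrier ell2"
proof -
  have "(\<lambda>i. K\<^sup>2 * (cmod (x i))\<^sup>2) summable_on UNIV"
    using assms by (intro summable_on_cmult_right) (simp add: mem_ell2_iff)
  moreover have "(cmod (c i * x i))\<^sup>2 \<le> K\<^sup>2 * (cmod (x i))\<^sup>2" for i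
    using assms(2)[of i] by (simp add: norm_mult power_mult_distrib mult_right_mono power_mono)
  ultimately show ?thesis
    unfolding mem_ell2_iff by - (rule summable_on_comparison_test, assumption, simp_all)
qed

lemma ell2_smult_mem: "x \<in> carrier ell2 \<Longrightarrow> (\<lambda>i. c * x i) \<in> carrier ell2"
  by (rule ell2_bounded_mult_mem[where K = "cmod c"]) simp_all

lemma ell2_zero_mem: "(\<lambda>i. 0) \<in> carrier ell2"
  by (simp add: mem_ell2_iff)

lemma ell2_cinner_abs_summable:
  assumes "x \<in> carrier ell2" "y \<in> carrier ell2"
  shows "(\<lambda>i. cmod (x i * cnj (y i))) summable_on UNIV"
proof -
  have "cmod (x i * cnj (y i)) \<le> (cmod (x i))\<^sup>2 + (cmod (y i))\<^sup>2" for i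
    using sum_squares_bound[of "cmod (x i)" "cmod (y i)"]
      mult_nonneg_nonneg[OF norm_ge_zero norm_ge_zero, of "x i" "y i"]
    unfolding norm_mult complex_mod_cnj by linarith
  moreover have "(\<lambda>i. (cmod (x i))\<^sup>2 + (cmod (y i))\<^sup>2) summable_on UNIV"
    using assms by (intro summable_on_add) (simp_all add: mem_ell2_iff)
  ultimately show ?thesis
    by - (rule summable_on_comparison_test, assumption, simp_all)
qed

lemma ell2_cinner_summable:
  assumes "x \<in> carrier ell2" "y \<in> carrier ell2"
  shows "(\<lambda>i. x i * cnj (y i)) summable_on UNIV"
  using ell2_cinner_abs_summable[OF assms] by (rule abs_summable_summable)

text \<open>The identity holds for every family: the real and the complex sum are summable
  simultaneously, and \<open>infsum\<close> is 0 on both sides when they are not.\<close>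

lemma cinner_ell2_self: "cinner ell2 x x = of_real (\<Sum>\<^sub>\<infinity>i. (cmod (x i))\<^sup>2)"
proof -
  have "(\<lambda>i. complex_of_real ((cmod (x i))\<^sup>2)) summable_on UNIV \<longleftrightarrow> (\<lambda>i. (cmod (x i))\<^sup>2) summable_on UNIV"
    using summable_on_of_real[of "\<lambda>i. (cmod (x i))\<^sup>2" UNIV, where ?'a = complex]
      summable_on_Re[of "\<lambda>i. complex_of_real ((cmod (x i))\<^sup>2)" UNIV]
    by (simp only: Re_complex_of_real) blast
  then show ?thesis
    by (simp only: cinner_ell2 complex_norm_square[symmetric]
        infsum_bounded_linear_strong[OF _ bounded_linear_of_real])
qed

lemma hnorm_ell2: "hnorm ell2 x = sqrt (\<Sum>\<^sub>\<infinity>i. (cmod (x i))\<^sup>2)"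
  by (simp add: hnorm_def cinner_ell2_self)

lemma hnorm_ell2_sq: "(hnorm ell2 x)\<^sup>2 = (\<Sum>\<^sub>\<infinity>i. (cmod (x i))\<^sup>2)"
  by (simp add: hnorm_ell2 infsum_nonneg)

lemma complex_inner_product_space_ell2:
  "complex_inner_product_space (ell2 :: ('a \<Rightarrow> complex) inner_space)"
proof -
  have "abelian_group (ell2 :: ('a \<Rightarrow> complex) inner_space)"
  proof (rule abelian_groupI)
    fix x :: "'a \<Rightarrow> complex" assume "x \<in> carrier ell2"
    then show "\<exists>y\<in>carrier ell2. y \<oplus>\<^bsub>ell2\<^esub> x = \<zero>\<^bsub>ell2\<^esub>"
      by (intro bexI[of _ "\<lambda>i. - 1 * x i"] ell2_smult_mem) auto
  qed (auto simp: ell2_add_mem ell2_zero_mem add_ac)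
  then have module: "Module.module complex_field (ell2 :: ('a \<Rightarrow> complex) inner_space)"
    by (intro moduleI cring_complex_field) (auto simp: ell2_smult_mem algebra_simps)
  interpret Module.module complex_field "ell2 :: ('a \<Rightarrow> complex) inner_space"
    by (rule module)
  show ?thesis
  proof
    fix x y z :: "'a \<Rightarrow> complex"
    assume x: "x \<in> carrier ell2" and y: "y \<in> carrier ell2"
    show "cinner ell2 (x \<oplus>\<^bsub>ell2\<^esub> y) z = cinner ell2 x z + cinner ell2 y z" if "z \<in> carrier ell2"
      using infsum_add[OF ell2_cinner_summable[OF x that] ell2_cinner_summable[OF y that]]
      by (simp add: cinner_ell2 distrib_right)
    show "cinner ell2 (c \<odot>\<^bsub>ell2\<^esub> x) y = c * cinner ell2 x y" for c
      by (simp add: cinner_ell2 mult.assoc infsum_cmult_right')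
    show "cinner ell2 y x = cnj (cinner ell2 x y)"
      by (simp add: cinner_ell2 infsum_cnj[symmetric] mult.commute del: infsum_cnj)
  next
    fix x :: "'a \<Rightarrow> complex"
    assume x: "x \<in> carrier ell2"
    show "cinner ell2 x x \<in> \<real>\<^sub>\<ge>\<^sub>0"
      by (simp add: cinner_ell2_self infsum_nonneg)
    assume "cinner ell2 x x = 0"
    then have "(\<Sum>\<^sub>\<infinity>i. (cmod (x i))\<^sup>2) = 0"
      by (simp add: cinner_ell2_self)
    then have "(cmod (x i))\<^sup>2 = 0" for i
      using x nonneg_infsum_le_0D[of "\<lambda>i. (cmod (x i))\<^sup>2" UNIV i] by (simp add: mem_ell2_iff)
    then show "x = \<zero>\<^bsub>ell2\<^esub>"
      by auto
  qed
qed

interpretation ell2: complex_inner_product_space ell2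
  by (rule complex_inner_product_space_ell2)

lemma ell2_uminus [simp]: "x \<in> carrier ell2 \<Longrightarrow> \<ominus>\<^bsub>ell2\<^esub> x = (\<lambda>i. - x i)"
  by (simp add: ell2.minus_eq_smult)

lemma ell2_minus [simp]: "y \<in> carrier ell2 \<Longrightarrow> x \<ominus>\<^bsub>ell2\<^esub> y = (\<lambda>i. x i - y i)"
  by (simp add: a_minus_def)

section \<open>Finite partial sums and completeness\<close>

lemma ell2_finite_sum_le:
  assumes "x \<in> carrier ell2" "finite F"
  shows "(\<Sum>i\<in>F. (cmod (x i))\<^sup>2) \<le> (hnorm ell2 x)\<^sup>2"
  unfolding hnorm_ell2_sq using assms by (intro finite_sum_le_infsum) (simp_all add: mem_ell2_iff)

text \<open>Uniform bounds on finite partial sums survive pointwise limits. They serve as the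
  criterion for membership here and for norm estimates in \<open>hnorm_ell2_leI\<close>.\<close>

lemma ell2_memI:
  assumes "\<And>F. finite F \<Longrightarrow> (\<Sum>i\<in>F. (cmod (x i))\<^sup>2) \<le> K"
  shows "x \<in> carrier ell2"
  unfolding mem_ell2_iff
  by (rule nonneg_bdd_above_summable_on) (auto intro!: bdd_aboveI[of _ K] assms)

lemma hnorm_ell2_leI:
  assumes "\<And>F. finite F \<Longrightarrow> (\<Sum>i\<in>F. (cmod (x i))\<^sup>2) \<le> K\<^sup>2" "0 \<le> K"
  shows "hnorm ell2 x \<le> K"
proof (rule power2_le_imp_le)
  show "(hnorm ell2 x)\<^sup>2 \<le> K\<^sup>2"
    unfolding hnorm_ell2_sq
    using assms ell2_memI[of x "K\<^sup>2"] by (intro infsum_le_finite_sums) (auto simp: mem_ell2_iff)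
qed (fact assms)

lemma ell2_component_le:
  assumes "x \<in> carrier ell2"
  shows "cmod (x i) \<le> hnorm ell2 x"
  using ell2_finite_sum_le[OF assms, of "{i}"] assms by - (rule power2_le_imp_le, simp_all)

text \<open>A Cauchy sequence converges in each component. The Cauchy estimate, restricted to a
  finite index set, passes to the componentwise limit with a bound independent of that set.\<close>

lemma hilbert_space_ell2: "hilbert_space (ell2 :: ('a \<Rightarrow> complex) inner_space)"
proof
  interpret M: Metric_space "carrier ell2" "hdist (ell2 :: ('a \<Rightarrow> complex) inner_space)"
    by (rule ell2.Metric_space_hdist)
  show "M.mcomplete"
    unfolding M.mcomplete_def
  proof (intro allI impI)
    fix f :: "nat \<Rightarrow> 'a \<Rightarrow> complex"
    assume f: "M.MCauchy f"
    then have mem: "f n \<in> carrier ell2" for n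
      by (auto simp: M.MCauchy_def)
    have dist: "hdist ell2 (f m) (f n) = hnorm ell2 (\<lambda>i. f m i - f n i)" for m n
      by (simp add: hdist_def mem)
    have diff: "(\<lambda>i. f m i - f n i) \<in> carrier ell2" for m n
      using ell2.minus_closed[OF mem[of m] mem[of n]] mem by simp
    have cauchy: "\<exists>N. \<forall>m\<ge>N. \<forall>n\<ge>N. hnorm ell2 (\<lambda>i. f m i - f n i) < e" if "e > 0" for e
      using f that unfolding M.MCauchy_def dist by presburger
    have "Cauchy (\<lambda>n. f n i)" for i
      unfolding Cauchy_def dist_norm
    proof (intro allI impI)
      fix e :: real assume "e > 0"
      then show "\<exists>M. \<forall>m\<ge>M. \<forall>n\<ge>M. cmod (f m i - f n i) < e"
        using cauchy[of e] le_less_trans[OF ell2_component_le[OF diff]] by fast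
    qed
    then have "\<exists>g. \<forall>i. (\<lambda>n. f n i) \<longlonglongrightarrow> g i"
      by (intro choice) (auto simp: Cauchy_convergent_iff convergent_def)
    then obtain g where g: "\<And>i. (\<lambda>n. f n i) \<longlonglongrightarrow> g i"
      by blast
    have tail: "\<exists>N. \<forall>n\<ge>N. \<forall>F. finite F \<longrightarrow> (\<Sum>i\<in>F. (cmod (f n i - g i))\<^sup>2) \<le> e\<^sup>2" if "e > 0" for e
    proof -
      obtain N where N: "\<And>m n. m \<ge> N \<Longrightarrow> n \<ge> N \<Longrightarrow> hnorm ell2 (\<lambda>i. f m i - f n i) < e"
        using cauchy[OF \<open>e > 0\<close>] by presburger
      have "(\<Sum>i\<in>F. (cmod (f n i - g i))\<^sup>2) \<le> e\<^sup>2" if n: "n \<ge> N" and F: "finite F" for n F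
      \<comment> \<open>With \<open>n\<close> and the finite set \<open>F\<close> fixed, only the
        second index \<open>m\<close> tends to infinity.\<close>
      proof (rule LIMSEQ_le_const2)
        show "(\<lambda>m. \<Sum>i\<in>F. (cmod (f n i - f m i))\<^sup>2) \<longlonglongrightarrow> (\<Sum>i\<in>F. (cmod (f n i - g i))\<^sup>2)"
          by (intro tendsto_intros g)
        have "(\<Sum>i\<in>F. (cmod (f n i - f m i))\<^sup>2) \<le> e\<^sup>2" if "m \<ge> N" for m
          using ell2_finite_sum_le[OF diff F, of n m] N[OF n that] ell2.hnorm_nonneg[OF diff, of n m]
          by (smt (verit) power_mono)
        then show "\<exists>N. \<forall>m\<ge>N. (\<Sum>i\<in>F. (cmod (f n i - f m i))\<^sup>2) \<le> e\<^sup>2"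
          by blast
      qed
      then show ?thesis
        by blast
    qed
    have gmem: "g \<in> carrier ell2"
    proof -
      obtain n where "\<And>F. finite F \<Longrightarrow> (\<Sum>i\<in>F. (cmod (f n i - g i))\<^sup>2) \<le> 1"
        using tail[of 1] by auto
      then have "(\<lambda>i. f n i - g i) \<in> carrier ell2"
        by (rule ell2_memI)
      \<comment> \<open>The limit is recovered as g = f n - (f n - g), a difference of two square
        summable families.\<close>
      from ell2.minus_closed[OF mem[of n] this] this show ?thesis
        by simp
    qed
    have "hdist ell2 (f n) g = hnorm ell2 (\<lambda>i. f n i - g i)" for n
      by (simp add: hdist_def mem gmem)
    moreover have "\<exists>N. \<forall>n\<ge>N. hnorm ell2 (\<lambda>i. f n i - g i) < e" if "e > 0" for e
    proof -
      \<comment> \<open>Half of \<open>e\<close> is used because passing to the limit leaves only a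
        non-strict bound.\<close>
      obtain N where N: "\<And>n F. n \<ge> N \<Longrightarrow> finite F \<Longrightarrow> (\<Sum>i\<in>F. (cmod (f n i - g i))\<^sup>2) \<le> (e / 2)\<^sup>2"
        using tail[of "e / 2"] \<open>e > 0\<close> by auto
      have "hnorm ell2 (\<lambda>i. f n i - g i) < e" if "n \<ge> N" for n
        using hnorm_ell2_leI[of "\<lambda>i. f n i - g i" "e / 2"] N[OF that] \<open>e > 0\<close> by fastforce
      then show ?thesis
        by blast
    qed
    ultimately have "limitin M.mtopology f g sequentially"
      using gmem mem by (simp add: M.limit_metric_sequentially)
    then show "\<exists>g. limitin M.mtopology f g sequentially"
      by blast
  qed
qed

section \<open>Truncation and adjoints\<close>

definition ket :: "'i \<Rightarrow> 'i \<Rightarrow> complex" where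
  "ket i = (\<lambda>j. if j = i then 1 else 0)"

text \<open>Defined on arbitrary families: it is also applied to \<open>S y\<close> before that
  family is known to be square summable, and to quotients by the weights, which may fail to
  be.\<close>

definition trunc :: "'i set \<Rightarrow> ('i \<Rightarrow> complex) \<Rightarrow> 'i \<Rightarrow> complex" where
  "trunc F x = (\<lambda>i. if i \<in> F then x i else 0)"

lemma trunc_finite_mem:
  assumes "finite F"
  shows "trunc F x \<in> carrier ell2"
  unfolding mem_ell2_iff
proof (rule finite_nonzero_values_imp_summable_on)
  show "finite {i \<in> UNIV. (cmod (trunc F x i))\<^sup>2 \<noteq> 0}"
    by (rule finite_subset[OF _ assms]) (auto simp: trunc_def)
qed

lemma trunc_ket: "trunc {i} (\<lambda>_. 1) = ket i"
  by (auto simp: trunc_def ket_def)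

lemma ket_mem [simp]: "ket i \<in> carrier ell2"
  unfolding trunc_ket[symmetric] by (rule trunc_finite_mem) simp

lemma infsum_finite_support:
  assumes "finite F" "\<And>i. i \<notin> F \<Longrightarrow> f i = 0"
  shows "infsum f UNIV = sum f F"
  by (subst infsum_cong_neutral[of F UNIV f f]) (use assms in auto)

lemma hnorm_trunc_sq:
  assumes "finite F"
  shows "(hnorm ell2 (trunc F x))\<^sup>2 = (\<Sum>i\<in>F. (cmod (x i))\<^sup>2)"
  unfolding hnorm_ell2_sq using assms
  by (subst infsum_finite_support[of F]) (auto simp: trunc_def)

lemma cinner_ket: "cinner ell2 x (ket i) = x i"
  unfolding cinner_ell2 by (subst infsum_finite_support[of "{i}"]) (auto simp: ket_def)

text \<open>By Pythagoras the squared error is the squared norm of \<open>x\<close> minus a finite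
  partial sum of the series for that squared norm.\<close>

lemma hnorm_minus_trunc_tendsto:
  assumes x: "x \<in> carrier ell2"
  shows "((\<lambda>F. hnorm ell2 (x \<ominus>\<^bsub>ell2\<^esub> trunc F x)) \<longlongrightarrow> 0) (finite_subsets_at_top UNIV)"
proof -
  have "((\<lambda>F. \<Sum>i\<in>F. (cmod (x i))\<^sup>2) \<longlongrightarrow> (hnorm ell2 x)\<^sup>2) (finite_subsets_at_top UNIV)"
    unfolding hnorm_ell2_sq using x by (intro infsum_tendsto) (simp add: mem_ell2_iff)
  then have "((\<lambda>F. sqrt ((hnorm ell2 x)\<^sup>2 - (\<Sum>i\<in>F. (cmod (x i))\<^sup>2))) \<longlongrightarrow>
      sqrt ((hnorm ell2 x)\<^sup>2 - (hnorm ell2 x)\<^sup>2)) (finite_subsets_at_top UNIV)"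
    by (intro tendsto_intros)
  moreover have "sqrt ((hnorm ell2 x)\<^sup>2 - (\<Sum>i\<in>F. (cmod (x i))\<^sup>2)) = hnorm ell2 (x \<ominus>\<^bsub>ell2\<^esub> trunc F x)"
    if F: "finite F" for F
  proof -
    have t: "trunc F x \<in> carrier ell2"
      by (rule trunc_finite_mem[OF F])
    with x have d: "x \<ominus>\<^bsub>ell2\<^esub> trunc F x \<in> carrier ell2"
      by (rule ell2.minus_closed)
    \<comment> \<open>The truncation and the remainder have disjoint supports, so at each index one
      of the two terms is zero.\<close>
    have "(cmod (x i))\<^sup>2 = (cmod (trunc F x i))\<^sup>2 + (cmod ((x \<ominus>\<^bsub>ell2\<^esub> trunc F x) i))\<^sup>2" for i
      using t by (simp add: trunc_def)
    then have "(hnorm ell2 x)\<^sup>2 = (hnorm ell2 (trunc F x))\<^sup>2 + (hnorm ell2 (x \<ominus>\<^bsub>ell2\<^esub> trunc F x))\<^sup>2"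
      using infsum_add[of "\<lambda>i. (cmod (trunc F x i))\<^sup>2" UNIV
          "\<lambda>i. (cmod ((x \<ominus>\<^bsub>ell2\<^esub> trunc F x) i))\<^sup>2"] t d
      unfolding hnorm_ell2_sq mem_ell2_iff by presburger
    then show ?thesis
      using d hnorm_trunc_sq[OF F, of x] ell2.hnorm_nonneg[OF d] by (simp add: real_sqrt_unique)
  qed
  then have "\<forall>\<^sub>F F in finite_subsets_at_top UNIV.
      sqrt ((hnorm ell2 x)\<^sup>2 - (\<Sum>i\<in>F. (cmod (x i))\<^sup>2)) = hnorm ell2 (x \<ominus>\<^bsub>ell2\<^esub> trunc F x)"
    by (intro eventually_finite_subsets_at_top_weakI) simp
  ultimately show ?thesis
    by (simp add: tendsto_cong)
qed

text \<open>Every ball around \<open>x\<close> contains a truncation of \<open>x\<close>. This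
  settles the range condition in the definition of the parallel factor.\<close>

lemma norm_closure_ell2:
  assumes "\<And>F x. finite F \<Longrightarrow> x \<in> carrier ell2 \<Longrightarrow> trunc F x \<in> S"
  shows "carrier ell2 \<subseteq> norm_closure ell2 S"
proof
  interpret M: Metric_space "carrier ell2" "hdist (ell2 :: ('a \<Rightarrow> complex) inner_space)"
    by (rule ell2.Metric_space_hdist)
  fix x :: "'a \<Rightarrow> complex" assume x: "x \<in> carrier ell2"
  have "\<exists>y\<in>S. y \<in> M.mball x r" if "r > 0" for r
  proof -
    have "\<forall>\<^sub>F F in finite_subsets_at_top UNIV. hnorm ell2 (x \<ominus>\<^bsub>ell2\<^esub> trunc F x) < r"
      using order_tendstoD(2)[OF hnorm_minus_trunc_tendsto[OF x] that] .
    then obtain F where "finite F" "hnorm ell2 (x \<ominus>\<^bsub>ell2\<^esub> trunc F x) < r"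
      unfolding eventually_finite_subsets_at_top by blast
    then show ?thesis
      using x assms trunc_finite_mem by (intro bexI[of _ "trunc F x"]) (auto simp: hdist_def)
  qed
  then show "x \<in> norm_closure ell2 S"
    using x unfolding norm_closure_def M.metric_closure_of by blast
qed

section \<open>Matrix entries of an operator and existence of its adjoint\<close>

lemma cinner_op_trunc:
  assumes T: "T \<in> carrier (\<BB> ell2)" and y: "y \<in> carrier ell2" and F: "finite F"
  shows "cinner ell2 (T (trunc F x)) y = (\<Sum>j\<in>F. x j * cinner ell2 (T (ket j)) y)"
  using F
proof induction
  case empty
  have "trunc {} x = \<zero>\<^bsub>ell2\<^esub>"
    by (simp add: trunc_def)
  then show ?case
    using T y ell2.op_zero[OF T] ell2.cinner_zero_left[OF y] by simp
next
  case (insert j F)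
  have "trunc (insert j F) x = (x j \<odot>\<^bsub>ell2\<^esub> ket j) \<oplus>\<^bsub>ell2\<^esub> trunc F x"
    using insert by (auto simp: trunc_def ket_def)
  moreover have "x j \<odot>\<^bsub>ell2\<^esub> ket j \<in> carrier ell2" "trunc F x \<in> carrier ell2"
    using insert by (auto intro: ell2_smult_mem trunc_finite_mem simp del: smult_ell2) 
  ultimately have "cinner ell2 (T (trunc (insert j F) x)) y
      = x j * cinner ell2 (T (ket j)) y + cinner ell2 (T (trunc F x)) y"
    using T y by (simp only: ell2.op_add ell2.op_smult ell2.cinner_add_left ell2.cinner_smult_left
        ell2.op_mem ket_mem ell2.smult_mem)
  then show ?case
    using insert by simp
qed

text \<open>On truncations the formula is finite linearity. By Cauchy-Schwarz and boundedness of
  \<open>T\<close> the remaining error is at most K |x - trunc F x| |y|, which tends to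
  zero.\<close>

lemma cinner_op_has_sum:
  assumes T: "T \<in> carrier (\<BB> ell2)" and x: "x \<in> carrier ell2" and y: "y \<in> carrier ell2"
  shows "((\<lambda>j. x j * cinner ell2 (T (ket j)) y) has_sum cinner ell2 (T x) y) UNIV"
proof -
  obtain K where K: "\<And>x. x \<in> carrier ell2 \<Longrightarrow> hnorm ell2 (T x) \<le> K * hnorm ell2 x"
    using ell2.op_bounded[OF T] by metis
  have le: "cmod ((\<Sum>j\<in>F. x j * cinner ell2 (T (ket j)) y) - cinner ell2 (T x) y)
      \<le> K * hnorm ell2 (x \<ominus>\<^bsub>ell2\<^esub> trunc F x) * hnorm ell2 y" if F: "finite F" for F
  proof -
    note t = trunc_finite_mem[OF F, of x]
    have d: "x \<ominus>\<^bsub>ell2\<^esub> trunc F x \<in> carrier ell2"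
      using x t by (rule ell2.minus_closed)
    have "cinner ell2 (T (x \<ominus>\<^bsub>ell2\<^esub> trunc F x)) y
        = cinner ell2 (T x) y - (\<Sum>j\<in>F. x j * cinner ell2 (T (ket j)) y)"
      using T x y t
      by (simp only: ell2.op_minus ell2.cinner_minus_left ell2.op_mem cinner_op_trunc[OF T y F])
    then have "cmod ((\<Sum>j\<in>F. x j * cinner ell2 (T (ket j)) y) - cinner ell2 (T x) y)
        = cmod (cinner ell2 (T (x \<ominus>\<^bsub>ell2\<^esub> trunc F x)) y)"
      by (simp only: norm_minus_commute)
    also have "\<dots> \<le> hnorm ell2 (T (x \<ominus>\<^bsub>ell2\<^esub> trunc F x)) * hnorm ell2 y"
      by (rule ell2.Cauchy_Schwarz[OF ell2.op_mem[OF T d] y])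
    also have "\<dots> \<le> K * hnorm ell2 (x \<ominus>\<^bsub>ell2\<^esub> trunc F x) * hnorm ell2 y"
      using K[OF d] y by (intro mult_right_mono ell2.hnorm_nonneg)
    finally show ?thesis .
  qed
  have "((\<lambda>F. K * hnorm ell2 (x \<ominus>\<^bsub>ell2\<^esub> trunc F x) * hnorm ell2 y) \<longlongrightarrow> K * 0 * hnorm ell2 y)
      (finite_subsets_at_top UNIV)"
    by (intro tendsto_intros hnorm_minus_trunc_tendsto x)
  then have "((\<lambda>F. K * hnorm ell2 (x \<ominus>\<^bsub>ell2\<^esub> trunc F x) * hnorm ell2 y) \<longlongrightarrow> 0)
      (finite_subsets_at_top UNIV)"
    by (simp only: mult_zero_left mult_zero_right)
  moreover have "\<forall>\<^sub>F F in finite_subsets_at_top UNIV.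
      cmod ((\<Sum>j\<in>F. x j * cinner ell2 (T (ket j)) y) - cinner ell2 (T x) y)
      \<le> K * hnorm ell2 (x \<ominus>\<^bsub>ell2\<^esub> trunc F x) * hnorm ell2 y"
    by (rule eventually_finite_subsets_at_top_weakI) (rule le)
  ultimately have "((\<lambda>F. (\<Sum>j\<in>F. x j * cinner ell2 (T (ket j)) y) - cinner ell2 (T x) y) \<longlongrightarrow> 0)
      (finite_subsets_at_top UNIV)"
    by (rule Lim_null_comparison[rotated])
  then show ?thesis
    unfolding has_sum_def by (rule LIM_zero_cancel)
qed

text \<open>The adjoint is written down by its components, the conjugates of <T e_j, y> for the
  basis vectors e_j. That these are square summable follows by testing \<open>T\<close> on
  truncations of the candidate vector itself.\<close>

lemma adjoint_ell2:
  assumes T: "T \<in> carrier (\<BB> ell2)"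
  shows "adjoint_op ell2 T \<in> carrier (\<BB> ell2)"
    and "\<And>x y. x \<in> carrier ell2 \<Longrightarrow> y \<in> carrier ell2 \<Longrightarrow>
      cinner ell2 (T x) y = cinner ell2 x (adjoint_op ell2 T y)"
proof -
  define S where "S = (\<lambda>y\<in>carrier ell2. \<lambda>j. cnj (cinner ell2 (T (ket j)) y))"
  obtain K where K0: "K \<ge> 0"
    and K: "\<And>x. x \<in> carrier ell2 \<Longrightarrow> hnorm ell2 (T x) \<le> K * hnorm ell2 x"
    using ell2.op_bounded[OF T] by metis
  have le: "(\<Sum>j\<in>F. (cmod (S y j))\<^sup>2) \<le> (K * hnorm ell2 y)\<^sup>2"
    if y: "y \<in> carrier ell2" and F: "finite F" for y F
  proof -
    define n where "n = hnorm ell2 (trunc F (S y))"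
    note t = trunc_finite_mem[OF F, of "S y"]
    have n0: "n \<ge> 0"
      using ell2.hnorm_nonneg[OF t] by (simp add: n_def)
    have n: "n\<^sup>2 = (\<Sum>j\<in>F. (cmod (S y j))\<^sup>2)"
      unfolding n_def by (rule hnorm_trunc_sq[OF F])
    \<comment> \<open>The squared norm of the truncated candidate is itself a value of the form <T
      z, y>, with \<open>z\<close> that truncation. Boundedness gives n^2 \<le> K n |y|, and one
      factor \<open>n\<close> cancels.\<close>
    have "of_real (n\<^sup>2) = (\<Sum>j\<in>F. S y j * cnj (S y j))"
      unfolding n of_real_sum complex_norm_square ..
    also have "\<dots> = cinner ell2 (T (trunc F (S y))) y"
      using y by (simp add: cinner_op_trunc[OF T y F] S_def)
    finally have "n\<^sup>2 = cmod (cinner ell2 (T (trunc F (S y))) y)"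
      by (metis abs_of_nonneg norm_of_real zero_le_power2)
    also have "\<dots> \<le> hnorm ell2 (T (trunc F (S y))) * hnorm ell2 y"
      by (rule ell2.Cauchy_Schwarz[OF ell2.op_mem[OF T t] y])
    also have "\<dots> \<le> K * n * hnorm ell2 y"
      unfolding n_def using K[OF t] y by (intro mult_right_mono ell2.hnorm_nonneg)
    finally have "n * n \<le> n * (K * hnorm ell2 y)"
      by (simp add: power2_eq_square mult_ac)
    then have "n \<le> K * hnorm ell2 y"
      using n0 K0 ell2.hnorm_nonneg[OF y] by (cases "n = 0") auto
    then show ?thesis
      using n0 unfolding n[symmetric] by (rule power_mono)
  qed
  have mem: "S y \<in> carrier ell2" if "y \<in> carrier ell2" for y
    using le[OF that] by (rule ell2_memI)
  have S: "S \<in> carrier (\<BB> ell2)"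
  proof (rule ell2.bounded_operatorI[where K = K])
    show "S \<in> carrier ell2 \<rightarrow>\<^sub>E carrier ell2"
      using mem by (auto simp: S_def)
    show "hnorm ell2 (S y) \<le> K * hnorm ell2 y" if "y \<in> carrier ell2" for y
      using le[OF that] K0 ell2.hnorm_nonneg[OF that] by (intro hnorm_ell2_leI) simp_all
    have TC: "T (ket j) \<in> carrier ell2" for j
      by (rule ell2.op_mem[OF T ket_mem])
    show "S (x \<oplus>\<^bsub>ell2\<^esub> y) = S x \<oplus>\<^bsub>ell2\<^esub> S y" if "x \<in> carrier ell2" "y \<in> carrier ell2" for x y
      using that ell2.add.m_closed[OF that] ell2.cinner_add_right[OF TC that]
      by (simp add: S_def)
    show "S (c \<odot>\<^bsub>ell2\<^esub> x) = c \<odot>\<^bsub>ell2\<^esub> S x" if "x \<in> carrier ell2" for c x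
      using that ell2.smult_mem[OF that, of c] ell2.cinner_smult_right[OF TC that, of _ c]
      by (simp add: S_def)
  qed
  have adj: "cinner ell2 (T x) y = cinner ell2 x (S y)"
    if "x \<in> carrier ell2" "y \<in> carrier ell2" for x y
    using infsumI[OF cinner_op_has_sum[OF T that]] that(2)
    by (simp add: cinner_ell2[of x] S_def)
  have "adjoint_op ell2 T = S"
    using S adj by (rule ell2.adjoint_op_eqI)
  with S adj show "adjoint_op ell2 T \<in> carrier (\<BB> ell2)"
    and "\<And>x y. x \<in> carrier ell2 \<Longrightarrow> y \<in> carrier ell2 \<Longrightarrow>
      cinner ell2 (T x) y = cinner ell2 x (adjoint_op ell2 T y)"
    by simp_all
qed

section \<open>Weighted swaps\<close>

lemma hnorm_bounded_mult:
  assumes x: "x \<in> carrier ell2" and c: "\<And>i. cmod (c i) \<le> K"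
  shows "hnorm ell2 (\<lambda>i. c i * x i) \<le> K * hnorm ell2 x"
proof (rule hnorm_ell2_leI)
  \<comment> \<open>\<open>undefined\<close> serves as an arbitrary index; the index type is
    nonempty.\<close>
  have K: "K \<ge> 0"
    using c[of undefined] norm_ge_zero order_trans by blast
  then show "0 \<le> K * hnorm ell2 x"
    using ell2.hnorm_nonneg[OF x] by simp
  fix F :: "'a set" assume F: "finite F"
  have "(\<Sum>i\<in>F. (cmod (c i * x i))\<^sup>2) \<le> (\<Sum>i\<in>F. K\<^sup>2 * (cmod (x i))\<^sup>2)"
    using c by (intro sum_mono) (simp add: norm_mult power_mult_distrib mult_right_mono power_mono)
  also have "\<dots> \<le> (K * hnorm ell2 x)\<^sup>2"
    using ell2_finite_sum_le[OF x F]
    by (simp add: sum_distrib_left[symmetric] power_mult_distrib mult_left_mono)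
  finally show "(\<Sum>i\<in>F. (cmod (c i * x i))\<^sup>2) \<le> (K * hnorm ell2 x)\<^sup>2" .
qed

text \<open>This is p + q U, where \<open>p\<close> and \<open>q\<close> act as diagonal
  multiplications and U x = x o s. For an involution \<open>s\<close>, sums, products and adjoints
  of bounded such operators have the same form, so identities between them reduce to their
  coefficients.\<close>

definition weighted_swap ::
  "('i \<Rightarrow> 'i) \<Rightarrow> ('i \<Rightarrow> real) \<Rightarrow> ('i \<Rightarrow> real) \<Rightarrow> ('i \<Rightarrow> complex) \<Rightarrow> 'i \<Rightarrow> complex" where
  "weighted_swap s p q =
     (\<lambda>x\<in>carrier ell2. \<lambda>i. of_real (p i) * x i + of_real (q i) * x (s i))"

context
  fixes s :: "'i \<Rightarrow> 'i"
  assumes s: "\<And>i. s (s i) = i"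
begin

lemma bij_betw_involution: "bij_betw s UNIV UNIV"
  by (rule bij_betw_byWitness[where f' = s]) (auto simp: s)

lemma ell2_swap_mem:
  assumes "x \<in> carrier ell2"
  shows "(\<lambda>i. x (s i)) \<in> carrier ell2"
  using assms summable_on_reindex_bij_betw[OF bij_betw_involution, of "\<lambda>i. (cmod (x i))\<^sup>2"]
  by (simp add: mem_ell2_iff)

lemma hnorm_swap: "hnorm ell2 (\<lambda>i. x (s i)) = hnorm ell2 x"
  using infsum_reindex_bij_betw[OF bij_betw_involution, of "\<lambda>i. (cmod (x i))\<^sup>2"]
  by (simp add: hnorm_ell2)

lemma weighted_swap_apply:
  "x \<in> carrier ell2 \<Longrightarrow>
    weighted_swap s p q x = (\<lambda>i. of_real (p i) * x i + of_real (q i) * x (s i))"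
  by (simp add: weighted_swap_def)

lemma weighted_swap_mem_BB:
  assumes p: "\<And>i. \<bar>p i\<bar> \<le> K" and q: "\<And>i. \<bar>q i\<bar> \<le> K"
  shows "weighted_swap s p q \<in> carrier (\<BB> ell2)"
proof (rule ell2.bounded_operatorI[where K = "2 * K"])
  have px: "(\<lambda>i. of_real (p i) * x i) \<in> carrier ell2"
    and qx: "(\<lambda>i. of_real (q i) * x (s i)) \<in> carrier ell2" if "x \<in> carrier ell2" for x
    using p q that ell2_swap_mem[OF that] by (auto intro!: ell2_bounded_mult_mem[where K = K])
  show "weighted_swap s p q \<in> carrier ell2 \<rightarrow>\<^sub>E carrier ell2"
    unfolding weighted_swap_def restrict_PiE_iff using ell2_add_mem[OF px qx] by blast
  show "hnorm ell2 (weighted_swap s p q x) \<le> 2 * K * hnorm ell2 x" if x: "x \<in> carrier ell2" for x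
  proof -
    have "hnorm ell2 (weighted_swap s p q x)
        \<le> hnorm ell2 (\<lambda>i. of_real (p i) * x i) + hnorm ell2 (\<lambda>i. of_real (q i) * x (s i))"
      using ell2.hnorm_triangle[OF px[OF x] qx[OF x]] by (simp add: weighted_swap_apply[OF x])
    also have "\<dots> \<le> K * hnorm ell2 x + K * hnorm ell2 (\<lambda>i. x (s i))"
      using p q x ell2_swap_mem[OF x] by (intro add_mono hnorm_bounded_mult) simp_all
    finally show ?thesis
      by (simp add: hnorm_swap)
  qed
  show "weighted_swap s p q (x \<oplus>\<^bsub>ell2\<^esub> y) = weighted_swap s p q x \<oplus>\<^bsub>ell2\<^esub> weighted_swap s p q y"
    if "x \<in> carrier ell2" "y \<in> carrier ell2" for x y
    using that ell2_add_mem[OF that] by (simp add: weighted_swap_apply algebra_simps)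
  show "weighted_swap s p q (c \<odot>\<^bsub>ell2\<^esub> x) = c \<odot>\<^bsub>ell2\<^esub> weighted_swap s p q x"
    if "x \<in> carrier ell2" for c x
    using that ell2_smult_mem[OF that] by (simp add: weighted_swap_apply algebra_simps)
qed

text \<open>Moving a diagonal multiplication past U composes its coefficients with \<open>s\<close>,
  and U U = 1.\<close>

lemma weighted_swap_mult:
  assumes T: "weighted_swap s p' q' \<in> carrier (\<BB> ell2)"
  shows "weighted_swap s p q \<otimes>\<^bsub>\<BB> ell2\<^esub> weighted_swap s p' q' =
    weighted_swap s (\<lambda>i. p i * p' i + q i * q' (s i)) (\<lambda>i. p i * q' i + q i * p' (s i))"
proof
  fix x
  show "(weighted_swap s p q \<otimes>\<^bsub>\<BB> ell2\<^esub> weighted_swap s p' q') x =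
    weighted_swap s (\<lambda>i. p i * p' i + q i * q' (s i)) (\<lambda>i. p i * q' i + q i * p' (s i)) x"
  proof (cases "x \<in> carrier ell2")
    case True
    then have "(weighted_swap s p q \<otimes>\<^bsub>\<BB> ell2\<^esub> weighted_swap s p' q') x =
        (\<lambda>i. of_real (p i) * weighted_swap s p' q' x i + of_real (q i) * weighted_swap s p' q' x (s i))"
      using ell2.op_mem[OF T True] by (simp only: ell2.mult_op_apply weighted_swap_apply)
    with True show ?thesis
      by (simp add: weighted_swap_apply s algebra_simps)
  next
    \<comment> \<open>Outside the carrier both sides take the value \<open>undefined\<close>, so the
      equality holds as one of functions.\<close>
    case False
    then show ?thesis
      by (simp add: weighted_swap_def \<BB>_def compose_def)
  qed
qed

lemma weighted_swap_add:
  "weighted_swap s p q \<oplus>\<^bsub>\<BB> ell2\<^esub> weighted_swap s p' q' =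
    weighted_swap s (\<lambda>i. p i + p' i) (\<lambda>i. q i + q' i)"
proof
  show "(weighted_swap s p q \<oplus>\<^bsub>\<BB> ell2\<^esub> weighted_swap s p' q') x =
    weighted_swap s (\<lambda>i. p i + p' i) (\<lambda>i. q i + q' i) x" for x
    by (cases "x \<in> carrier ell2") (simp_all add: weighted_swap_def \<BB>_def algebra_simps)
qed

text \<open>For real coefficients the adjoint of p + q U is p + U q, and moving \<open>q\<close>
  past U turns it into q o s.\<close>

lemma weighted_swap_adjoint_eq:
  assumes p: "\<And>i. \<bar>p i\<bar> \<le> K" and q: "\<And>i. \<bar>q i\<bar> \<le> K"
    and x: "x \<in> carrier ell2" and y: "y \<in> carrier ell2"
  shows "cinner ell2 (weighted_swap s p q x) y = cinner ell2 x (weighted_swap s p (\<lambda>i. q (s i)) y)"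
proof -
  have mult: "(\<lambda>i. of_real (p i) * z i) \<in> carrier ell2" "(\<lambda>i. of_real (q i) * z i) \<in> carrier ell2"
    "(\<lambda>i. of_real (q (s i)) * z i) \<in> carrier ell2" if "z \<in> carrier ell2" for z
    using p q that by (auto intro!: ell2_bounded_mult_mem[where K = K])
  note xs = ell2_swap_mem[OF x] and ys = ell2_swap_mem[OF y]
  have "cinner ell2 (weighted_swap s p q x) y
      = cinner ell2 (\<lambda>i. of_real (p i) * x i) y + cinner ell2 (\<lambda>i. of_real (q i) * x (s i)) y"
    using ell2.cinner_add_left[OF mult(1)[OF x] mult(2)[OF xs] y]
    by (simp add: weighted_swap_apply[OF x])
  also have "cinner ell2 (\<lambda>i. of_real (p i) * x i) y = cinner ell2 x (\<lambda>i. of_real (p i) * y i)"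
    by (simp add: cinner_ell2 mult_ac)
  also have "cinner ell2 (\<lambda>i. of_real (q i) * x (s i)) y
      = cinner ell2 x (\<lambda>i. of_real (q (s i)) * y (s i))"
    \<comment> \<open>Summing over \<open>s i\<close> instead of \<open>i\<close> moves the swap
      from \<open>x\<close> to \<open>y\<close>.\<close>
    using infsum_reindex_bij_betw[OF bij_betw_involution,
        of "\<lambda>i. of_real (q (s i)) * x i * cnj (y (s i))"]
    by (simp add: cinner_ell2 s mult_ac)
  also have "cinner ell2 x (\<lambda>i. of_real (p i) * y i) + cinner ell2 x (\<lambda>i. of_real (q (s i)) * y (s i))
      = cinner ell2 x (weighted_swap s p (\<lambda>i. q (s i)) y)"
    using ell2.cinner_add_right[OF x mult(1)[OF y] mult(3)[OF ys]]
    by (simp add: weighted_swap_apply[OF y])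
  finally show ?thesis .
qed

lemma adjoint_weighted_swap:
  assumes "\<And>i. \<bar>p i\<bar> \<le> K" "\<And>i. \<bar>q i\<bar> \<le> K"
  shows "adjoint_op ell2 (weighted_swap s p q) = weighted_swap s p (\<lambda>i. q (s i))"
  using assms by (intro ell2.adjoint_op_eqI weighted_swap_mem_BB weighted_swap_adjoint_eq) auto

section \<open>Positive diagonal operators and their square roots\<close>

lemma weighted_swap_diagonal_positive:
  assumes r: "\<And>i. 0 \<le> r i" "\<And>i. r i \<le> K"
  shows "weighted_swap s r (\<lambda>_. 0) \<in> positive_operators ell2"
proof -
  have K: "0 \<le> K"
    using r order_trans by blast
  have "cinner ell2 (weighted_swap s r (\<lambda>_. 0) x) x \<in> \<real>\<^sub>\<ge>\<^sub>0" if x: "x \<in> carrier ell2" for x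
  proof -
    \<comment> \<open>Distributing a root of the weight to each argument turns the quadratic form
      into a squared norm.\<close>
    define z where "z = (\<lambda>i. complex_of_real (sqrt (r i)) * x i)"
    have "cinner ell2 (weighted_swap s r (\<lambda>_. 0) x) x = cinner ell2 z z"
      unfolding cinner_ell2 using r
      by (intro infsum_cong) (simp add: weighted_swap_apply[OF x] z_def mult_ac flip: of_real_mult)
    then show ?thesis
      by (simp add: cinner_ell2_self infsum_nonneg)
  qed
  moreover have "weighted_swap s r (\<lambda>_. 0) \<in> carrier (\<BB> ell2)"
    using r K by (intro weighted_swap_mem_BB[where K = K]) auto
  ultimately show ?thesis
    by (simp add: positive_operators_def)
qed

text \<open>Uniqueness is the point. Any positive root has each basis vector as an eigenvector with
  eigenvalue \<open>r i\<close>, by \<open>positive_op_eigenvector\<close>, which is where strict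
  positivity of the weights enters.\<close>

lemma sqrt_op_diagonal:
  assumes r: "\<And>i. 0 < r i" "\<And>i. r i \<le> K"
  shows "sqrt_op ell2 (weighted_swap s (\<lambda>i. (r i)\<^sup>2) (\<lambda>_. 0)) = weighted_swap s r (\<lambda>_. 0)"
  unfolding sqrt_op_def
proof (rule the_equality)
  let ?R = "weighted_swap s r (\<lambda>_. 0)"
  let ?R2 = "weighted_swap s (\<lambda>i. (r i)\<^sup>2) (\<lambda>_. 0)"
  have pos: "?R \<in> positive_operators ell2"
    using r less_imp_le by (intro weighted_swap_diagonal_positive[where K = K]) blast+
  note R = ell2.positive_opD(1)[OF pos]
  show "?R \<in> positive_operators ell2 \<and> ?R \<otimes>\<^bsub>\<BB> ell2\<^esub> ?R = ?R2"
    using pos weighted_swap_mult[OF R, of r "\<lambda>_. 0"] by (simp add: power2_eq_square)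
  fix S assume S: "S \<in> positive_operators ell2 \<and> S \<otimes>\<^bsub>\<BB> ell2\<^esub> S = ?R2"
  then have Spos: "S \<in> positive_operators ell2" and SS: "S \<otimes>\<^bsub>\<BB> ell2\<^esub> S = ?R2"
    by blast+
  note SB = ell2.positive_opD(1)[OF Spos]
  have ket: "S (ket i) = of_real (r i) \<odot>\<^bsub>ell2\<^esub> ket i" for i
  proof (rule ell2.positive_op_eigenvector[OF Spos ket_mem r(1)])
    have "S (S (ket i)) = ?R2 (ket i)"
      unfolding SS[symmetric] by (rule ell2.mult_op_apply[OF ket_mem, symmetric])
    also have "\<dots> = of_real ((r i)\<^sup>2) \<odot>\<^bsub>ell2\<^esub> ket i"
      unfolding weighted_swap_apply[OF ket_mem] by (auto simp: ket_def)
    finally show "S (S (ket i)) = of_real ((r i)\<^sup>2) \<odot>\<^bsub>ell2\<^esub> ket i" .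
  qed
  show "S = ?R"
  proof (rule ell2.op_eqI[OF SB R])
    fix x :: "'i \<Rightarrow> complex" assume x: "x \<in> carrier ell2"
    show "S x = ?R x"
    proof
      fix i
      \<comment> \<open>Self-adjointness moves \<open>S\<close> onto the basis vector, so its values
        there determine all components of \<open>S x\<close>.\<close>
      have "S x i = cinner ell2 x (S (ket i))"
        using ell2.positive_op_selfadjoint[OF Spos x ket_mem, of i] by (simp add: cinner_ket)
      also have "\<dots> = of_real (r i) * x i"
        unfolding ket ell2.cinner_smult_right[OF x ket_mem] by (simp add: cinner_ket)
      finally show "S x i = ?R x i"
        using x by (simp add: weighted_swap_apply)
    qed
  qed
qed

text \<open>
  In the notation of the introduction, with \<open>e = 1\<close> or \<open>e = - 1\<close>, these are \<open>D (1 + e U) D / 2\<close>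
  and \<open>(1 + e U) D / 2\<close>.
\<close>

definition half_swap :: "('i \<Rightarrow> real) \<Rightarrow> real \<Rightarrow> ('i \<Rightarrow> complex) \<Rightarrow> 'i \<Rightarrow> complex" where
  "half_swap c e = weighted_swap s (\<lambda>i. (c i)\<^sup>2 / 2) (\<lambda>i. e * c i * c (s i) / 2)"

definition half_swap_factor :: "('i \<Rightarrow> real) \<Rightarrow> real \<Rightarrow> ('i \<Rightarrow> complex) \<Rightarrow> 'i \<Rightarrow> complex" where
  "half_swap_factor c e = weighted_swap s (\<lambda>i. c i / 2) (\<lambda>i. e * c (s i) / 2)"

section \<open>The pair of half swaps, their parallel sum and the operator equation\<close>

context
  fixes c :: "'i \<Rightarrow> real"
  assumes c_pos: "\<And>i. 0 < c i" and c_le: "\<And>i. c i \<le> 1"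
begin

lemma c_abs_le: "\<bar>c i / 2\<bar> \<le> 1" "e\<^sup>2 = 1 \<Longrightarrow> \<bar>e * c i / 2\<bar> \<le> 1"
  using c_pos[of i] c_le[of i] by (auto simp: power2_eq_1_iff)

lemma half_swap_factor_mem: "e\<^sup>2 = 1 \<Longrightarrow> half_swap_factor c e \<in> carrier (\<BB> ell2)"
  unfolding half_swap_factor_def by (intro weighted_swap_mem_BB[where K = 1] c_abs_le)

text \<open>If e^2 = 1, then (1 + e U) / 2 is an orthogonal projection P. The factor is P D, hence
  its adjoint times itself is D P D. The parameter \<open>e\<close> treats \<open>A\<close> and
  \<open>B\<close> together.\<close>

lemma adjoint_half_swap_factor_mult:
  assumes e: "e\<^sup>2 = 1"
  shows "adjoint_op ell2 (half_swap_factor c e) \<otimes>\<^bsub>\<BB> ell2\<^esub> half_swap_factor c e = half_swap c e"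
proof -
  have "adjoint_op ell2 (half_swap_factor c e) = weighted_swap s (\<lambda>i. c i / 2) (\<lambda>i. e * c (s (s i)) / 2)"
    unfolding half_swap_factor_def using e by (intro adjoint_weighted_swap[where K = 1] c_abs_le)
  moreover have ee: "e * (e * t) = t" for t
    by (metis e mult.assoc mult_1 power2_eq_square)
  ultimately show ?thesis
    using half_swap_factor_mem[OF e]
    by (simp add: half_swap_factor_def half_swap_def weighted_swap_mult s ee power2_eq_square field_simps)
qed

lemma half_swap_mem: "e\<^sup>2 = 1 \<Longrightarrow> half_swap c e \<in> carrier (\<BB> ell2)"
  unfolding adjoint_half_swap_factor_mult[symmetric]
  by (intro ell2.mult_op_mem adjoint_ell2(1) half_swap_factor_mem)

text \<open>Besides positivity, this lets a vanishing quadratic form be read as a vanishing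
  factor.\<close>

lemma cinner_half_swap:
  assumes e: "e\<^sup>2 = 1" and x: "x \<in> carrier ell2"
  shows "cinner ell2 (half_swap c e x) x = of_real ((hnorm ell2 (half_swap_factor c e x))\<^sup>2)"
proof -
  note F = half_swap_factor_mem[OF e]
  note Fx = ell2.op_mem[OF F x]
  note F'Fx = ell2.op_mem[OF adjoint_ell2(1)[OF F] Fx]
  have "cinner ell2 (half_swap c e x) x = cinner ell2 (adjoint_op ell2 (half_swap_factor c e) (half_swap_factor c e x)) x"
    unfolding adjoint_half_swap_factor_mult[OF e, symmetric] ell2.mult_op_apply[OF x] ..
  also have "\<dots> = cnj (cinner ell2 (half_swap_factor c e x) (half_swap_factor c e x))"
    unfolding ell2.cinner_commute[OF x F'Fx] adjoint_ell2(2)[OF F x Fx] ..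
  finally show ?thesis
    unfolding ell2.cinner_self[OF Fx] by simp
qed

lemma half_swap_positive: "e\<^sup>2 = 1 \<Longrightarrow> half_swap c e \<in> positive_operators ell2"
  unfolding positive_operators_def using half_swap_mem cinner_half_swap
  by (simp del: of_real_power)

text \<open>The root of A + B is multiplication by \<open>c\<close>. It is injective since the
  weights are nonzero, which gives uniqueness of the factor; its range is dense, which makes the
  range condition automatic.\<close>

lemma parallel_factor_half_swap:
  "parallel_factor ell2 (half_swap c 1) (half_swap c (- 1)) = half_swap_factor c 1"
proof -
  let ?R = "weighted_swap s c (\<lambda>_. 0)"
  have "half_swap c 1 \<oplus>\<^bsub>\<BB> ell2\<^esub> half_swap c (- 1) = weighted_swap s (\<lambda>i. (c i)\<^sup>2) (\<lambda>_. 0)"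
    by (simp add: half_swap_def weighted_swap_add)
  then have R: "sqrt_op ell2 (half_swap c 1 \<oplus>\<^bsub>\<BB> ell2\<^esub> half_swap c (- 1)) = ?R"
    using sqrt_op_diagonal[of c 1] c_pos c_le by simp
  have Rx: "?R x i = of_real (c i) * x i" if "x \<in> carrier ell2" for x i
    using that by (simp add: weighted_swap_apply)
  note F = half_swap_factor_mem[of 1, simplified]
  show ?thesis
    unfolding parallel_factor_def Let_def R
  proof (rule the_equality)
    have "?R \<otimes>\<^bsub>\<BB> ell2\<^esub> half_swap_factor c 1 = half_swap c 1"
      using F by (simp add: half_swap_factor_def half_swap_def weighted_swap_mult power2_eq_square)
    moreover have "carrier ell2 \<subseteq> norm_closure ell2 (?R ` carrier ell2)"
    proof (rule norm_closure_ell2)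
      fix G :: "'i set" and x assume G: "finite G"
      \<comment> \<open>Dividing by \<open>c\<close> may leave the space, as the weights need not be
        bounded below, but not on a finite set of indices.\<close>
      have "trunc G x = ?R (trunc G (\<lambda>i. x i / of_real (c i)))"
        by (rule ext, subst Rx[OF trunc_finite_mem[OF G]])
          (simp add: trunc_def less_imp_neq[OF c_pos, symmetric])
      then show "trunc G x \<in> ?R ` carrier ell2"
        using trunc_finite_mem[OF G] by blast
    qed
    ultimately show "half_swap_factor c 1 \<in> carrier (\<BB> ell2) \<and>
        ?R \<otimes>\<^bsub>\<BB> ell2\<^esub> half_swap_factor c 1 = half_swap c 1 \<and>
        half_swap_factor c 1 ` carrier ell2 \<subseteq> norm_closure ell2 (?R ` carrier ell2)"
      using F ell2.op_mem[OF F] by blast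
    fix F' assume "F' \<in> carrier (\<BB> ell2) \<and> ?R \<otimes>\<^bsub>\<BB> ell2\<^esub> F' = half_swap c 1 \<and>
        F' ` carrier ell2 \<subseteq> norm_closure ell2 (?R ` carrier ell2)"
    then have F': "F' \<in> carrier (\<BB> ell2)" and
      "?R \<otimes>\<^bsub>\<BB> ell2\<^esub> F' = ?R \<otimes>\<^bsub>\<BB> ell2\<^esub> half_swap_factor c 1"
      using \<open>?R \<otimes>\<^bsub>\<BB> ell2\<^esub> half_swap_factor c 1 = half_swap c 1\<close> by simp_all
    then have eq: "?R (F' x) = ?R (half_swap_factor c 1 x)" if "x \<in> carrier ell2" for x
      using ell2.mult_op_apply[OF that] by metis
    show "F' = half_swap_factor c 1"
    proof (rule ell2.op_eqI[OF F' F], rule ext)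
      fix x :: "'i \<Rightarrow> complex" and i assume x: "x \<in> carrier ell2"
      have "of_real (c i) * F' x i = of_real (c i) * half_swap_factor c 1 x i"
        using eq[OF x] Rx[OF ell2.op_mem[OF F' x]] Rx[OF ell2.op_mem[OF F x]] by metis
      then show "F' x i = half_swap_factor c 1 x i"
        using c_pos[of i] by simp
    qed
  qed
qed

lemma parallel_sum_half_swap:
  "parallel_sum ell2 (half_swap c 1) (half_swap c (- 1)) = \<zero>\<^bsub>\<BB> ell2\<^esub>"
proof -
  interpret BB: abelian_group "\<BB> (ell2 :: ('i \<Rightarrow> complex) inner_space)"
    by (rule ell2.abelian_group_BB)
  show ?thesis
    using half_swap_mem[of 1]
    by (simp add: parallel_sum_def parallel_factor_half_swap adjoint_half_swap_factor_mult
        a_minus_def BB.r_neg)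
qed

text \<open>Since the parallel sum is zero, pairing the equation with \<open>x\<close> yields two
  squared norms with sum zero. Both factors therefore vanish, at \<open>X x\<close> and at x - X x
  respectively.\<close>

lemma parallel_sum_equation_solution:
  assumes X: "X \<in> carrier (\<BB> ell2)"
    and eq: "parallel_sum ell2 (half_swap c 1) (half_swap c (- 1)) =
      adjoint_op ell2 X \<otimes>\<^bsub>\<BB> ell2\<^esub> half_swap c 1 \<otimes>\<^bsub>\<BB> ell2\<^esub> X \<oplus>\<^bsub>\<BB> ell2\<^esub>
      adjoint_op ell2 (\<one>\<^bsub>\<BB> ell2\<^esub> \<ominus>\<^bsub>\<BB> ell2\<^esub> X) \<otimes>\<^bsub>\<BB> ell2\<^esub> half_swap c (- 1) \<otimes>\<^bsub>\<BB> ell2\<^esub>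
        (\<one>\<^bsub>\<BB> ell2\<^esub> \<ominus>\<^bsub>\<BB> ell2\<^esub> X)"
    and x: "x \<in> carrier ell2"
  shows "of_real (c i) * (x i - 2 * X x i) = of_real (c (s i)) * x (s i)"
proof -
  define E where "E = \<one>\<^bsub>\<BB> ell2\<^esub> \<ominus>\<^bsub>\<BB> ell2\<^esub> X"
  have E: "E \<in> carrier (\<BB> ell2)"
    unfolding E_def by (rule ell2.minus_op_mem[OF ell2.one_op_mem X])
  have Xx: "X x \<in> carrier ell2" and Ex: "E x \<in> carrier ell2"
    by (rule ell2.op_mem[OF X x], rule ell2.op_mem[OF E x])
  have Exi: "E x i = x i - X x i" for i
    unfolding E_def ell2.minus_op_apply[OF ell2.one_op_mem X x] ell2.one_op_apply[OF x]
    using Xx by simp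
  define u where "u = half_swap c 1 (X x)"
  define v where "v = half_swap c (- 1) (E x)"
  have u: "u \<in> carrier ell2" and v: "v \<in> carrier ell2"
    unfolding u_def v_def
    by (rule ell2.op_mem[OF half_swap_mem Xx], simp, rule ell2.op_mem[OF half_swap_mem Ex], simp)
  have X'u: "adjoint_op ell2 X u \<in> carrier ell2" and E'v: "adjoint_op ell2 E v \<in> carrier ell2"
    by (rule ell2.op_mem[OF adjoint_ell2(1)[OF X] u], rule ell2.op_mem[OF adjoint_ell2(1)[OF E] v])
  have "\<zero>\<^bsub>ell2\<^esub> = adjoint_op ell2 X u \<oplus>\<^bsub>ell2\<^esub> adjoint_op ell2 E v"
    using fun_cong[OF eq[folded E_def, unfolded parallel_sum_half_swap], of x]
    by (simp only: u_def v_def ell2.zero_op_apply[OF x] ell2.add_op_apply[OF x]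
        ell2.mult_op_apply[OF x] ell2.mult_op_apply[OF Xx] ell2.mult_op_apply[OF Ex])
  then have "cinner ell2 x \<zero>\<^bsub>ell2\<^esub> = cinner ell2 x (adjoint_op ell2 X u) + cinner ell2 x (adjoint_op ell2 E v)"
    using ell2.cinner_add_right[OF x X'u E'v] by simp
  then have "0 = cinner ell2 (X x) u + cinner ell2 (E x) v"
    unfolding ell2.cinner_zero_right[OF x] adjoint_ell2(2)[OF X x u] adjoint_ell2(2)[OF E x v] .
  moreover have "cinner ell2 (X x) u = of_real ((hnorm ell2 (half_swap_factor c 1 (X x)))\<^sup>2)"
    using ell2.cinner_commute[OF u Xx] cinner_half_swap[OF _ Xx, of 1] by (simp add: u_def)
  moreover have "cinner ell2 (E x) v = of_real ((hnorm ell2 (half_swap_factor c (- 1) (E x)))\<^sup>2)"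
    using ell2.cinner_commute[OF v Ex] cinner_half_swap[OF _ Ex, of "- 1"] by (simp add: v_def)
  ultimately have "(hnorm ell2 (half_swap_factor c 1 (X x)))\<^sup>2 + (hnorm ell2 (half_swap_factor c (- 1) (E x)))\<^sup>2 = 0"
    by (simp flip: of_real_add of_real_power)
  then have "hnorm ell2 (half_swap_factor c 1 (X x)) = 0" "hnorm ell2 (half_swap_factor c (- 1) (E x)) = 0"
    by (simp_all add: sum_power2_eq_zero_iff)
  moreover have "half_swap_factor c 1 (X x) \<in> carrier ell2" "half_swap_factor c (- 1) (E x) \<in> carrier ell2"
    by (rule ell2.op_mem[OF half_swap_factor_mem Xx], simp, rule ell2.op_mem[OF half_swap_factor_mem Ex], simp)
  ultimately have "half_swap_factor c 1 (X x) = (\<lambda>_. 0)" "half_swap_factor c (- 1) (E x) = (\<lambda>_. 0)"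
    by (simp_all add: ell2.hnorm_eq_0_iff)
  then have "half_swap_factor c 1 (X x) i = 0" "half_swap_factor c (- 1) (E x) i = 0"
    by simp_all
  moreover have "of_real (c i) * X x i + of_real (c (s i)) * X x (s i) = 2 * half_swap_factor c 1 (X x) i"
    by (simp add: half_swap_factor_def weighted_swap_apply[OF Xx])
  moreover have "of_real (c i) * (x i - X x i) - of_real (c (s i)) * (x (s i) - X x (s i))
      = 2 * half_swap_factor c (- 1) (E x) i"
    by (simp add: half_swap_factor_def weighted_swap_apply[OF Ex] Exi)
  \<comment> \<open>Subtracting the two vanishing expressions cancels the values of
    \<open>X x\<close> at \<open>s i\<close>, so that only the component at \<open>i\<close>
    remains.\<close>
  moreover have "of_real (c i) * (x i - 2 * X x i) - of_real (c (s i)) * x (s i) =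
      (of_real (c i) * (x i - X x i) - of_real (c (s i)) * (x (s i) - X x (s i))) -
      (of_real (c i) * X x i + of_real (c (s i)) * X x (s i))"
    by (simp add: algebra_simps)
  ultimately have "of_real (c i) * (x i - 2 * X x i) - of_real (c (s i)) * x (s i) = 0"
    by (simp only: mult_zero_right diff_self)
  then show ?thesis
    by simp
qed

end

end

section \<open>Weights and a vector for which the operator equation fails\<close>

theorem theorem6p10:
  shows "\<exists>(H :: (nat \<Rightarrow> complex) inner_space) A B.
    hilbert_space H \<and> A \<in> positive_operators H \<and> B \<in> positive_operators H \<and>
    \<not> (\<exists>X \<in> carrier (\<BB> H).
      parallel_sum H A B =
        adjoint_op H X \<otimes>\<^bsub>\<BB> H\<^esub> A \<otimes>\<^bsub>\<BB> H\<^esub> X \<oplus>\<^bsub>\<BB> H\<^esub>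
        adjoint_op H (\<one>\<^bsub>\<BB> H\<^esub> \<ominus>\<^bsub>\<BB> H\<^esub> X) \<otimes>\<^bsub>\<BB> H\<^esub> B \<otimes>\<^bsub>\<BB> H\<^esub>
          (\<one>\<^bsub>\<BB> H\<^esub> \<ominus>\<^bsub>\<BB> H\<^esub> X))"
proof -
  define s :: "nat \<Rightarrow> nat" where "s i = (if even i then i + 1 else i - 1)" for i
  define c :: "nat \<Rightarrow> real" where "c i = (if even i then 1 else 1 / (real i + 1))" for i
  define x :: "nat \<Rightarrow> complex" where "x i = (if even i then 1 / (of_nat i + 2) else 0)" for i
    \<comment> \<open>chosen such that \<open>c (i - 1) x (i - 1) / c i = 1\<close> for odd \<open>i\<close>\<close>
  have s: "s (s i) = i" for i
    by (simp add: s_def)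
  have c: "0 < c i" "c i \<le> 1" for i
    by (simp_all add: c_def)
  have "summable (\<lambda>i. (cmod (x i))\<^sup>2)"
  proof (rule summable_comparison_test')
    show "summable (\<lambda>i. inverse (real i ^ 2))"
      by (rule inverse_power_summable) simp
    \<comment> \<open>The comparison starts at index 1, because \<open>inverse 0\<close> is 0 while
      \<open>x 0\<close> is 1/2.\<close>
    show "norm ((cmod (x i))\<^sup>2) \<le> inverse (real i ^ 2)" if "i \<ge> 1" for i
    proof -
      have "cmod (of_nat i + 2) = real i + 2"
        by (metis norm_of_nat of_nat_add of_nat_numeral)
      then have "cmod (x i) \<le> 1 / real i"
        using that by (auto simp: x_def norm_divide intro!: divide_left_mono)
      then have "(cmod (x i))\<^sup>2 \<le> (1 / real i)\<^sup>2"
        by (rule power_mono) simp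
      then show ?thesis
        by (simp add: power_divide inverse_eq_divide)
    qed
  qed
  then have x: "x \<in> carrier ell2"
    by (simp add: mem_ell2_iff summable_on_UNIV_nonneg_real_iff)
  have False if X: "X \<in> carrier (\<BB> ell2)" and
    "parallel_sum ell2 (half_swap s c 1) (half_swap s c (- 1)) =
      adjoint_op ell2 X \<otimes>\<^bsub>\<BB> ell2\<^esub> half_swap s c 1 \<otimes>\<^bsub>\<BB> ell2\<^esub> X \<oplus>\<^bsub>\<BB> ell2\<^esub>
      adjoint_op ell2 (\<one>\<^bsub>\<BB> ell2\<^esub> \<ominus>\<^bsub>\<BB> ell2\<^esub> X) \<otimes>\<^bsub>\<BB> ell2\<^esub> half_swap s c (- 1) \<otimes>\<^bsub>\<BB> ell2\<^esub>
        (\<one>\<^bsub>\<BB> ell2\<^esub> \<ominus>\<^bsub>\<BB> ell2\<^esub> X)" for X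
  proof -
    have eq: "of_real (c i) * (x i - 2 * X x i) = of_real (c (s i)) * x (s i)" for i
      by (rule parallel_sum_equation_solution[OF s c that x])
    \<comment> \<open>At odd \<open>i\<close> the vector \<open>x\<close> vanishes, and its partner
      i - 1 is even with weight 1. The equation thus reads -2 X x i / (i + 1) = 1 / (i + 1).\<close>
    have half: "X x i = - 1 / 2" if i: "odd i" for i
    proof -
      \<comment> \<open>Truncated subtraction on naturals is harmless, since an odd \<open>i\<close>
        is positive.\<close>
      have "of_nat (i - 1) + 2 = (of_nat i + 1 :: complex)"
        using i by (metis (no_types) add.assoc odd_pos Suc_pred' of_nat_Suc one_add_one add.commute)
      then have "- (2 * X x i) / (of_nat i + 1) = 1 / (of_nat i + 1)"
        using eq[of i] i by (simp add: c_def s_def x_def)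
      moreover have "(of_nat i + 1 :: complex) \<noteq> 0"
        by (metis of_nat_Suc of_nat_eq_0_iff nat.distinct(1) add.commute)
      ultimately have "- (2 * X x i) = 1"
        by (metis divide_cancel_right)
      then have "2 * X x i = - 1"
        by (metis minus_minus)
      then show ?thesis
        by (simp add: field_simps)
    qed
    have "(\<lambda>i. (cmod (X x i))\<^sup>2) summable_on UNIV"
      using ell2.op_mem[OF X x] by (simp only: mem_ell2_iff)
    then have "(\<lambda>i. (cmod (X x i))\<^sup>2) \<longlonglongrightarrow> 0"
      by (intro summable_LIMSEQ_zero summable_on_imp_summable)
    \<comment> \<open>The threshold is exactly the squared modulus of -1/2, the value at every odd
      index; 2 N + 1 is such an index beyond \<open>N\<close>.\<close>
    then have "\<forall>\<^sub>F i in sequentially. (cmod (X x i))\<^sup>2 < 1 / 4"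
      by (rule order_tendstoD) simp
    then obtain N where "\<And>i. i \<ge> N \<Longrightarrow> (cmod (X x i))\<^sup>2 < 1 / 4"
      unfolding eventually_sequentially by metis
    from this[of "2 * N + 1"] half[of "2 * N + 1"] show False
      by (simp add: power_divide)
  qed
  then show ?thesis
    using hilbert_space_ell2 half_swap_positive[OF s c, of 1] half_swap_positive[OF s c, of "- 1"]
    by (intro exI[of _ ell2] exI[of _ "half_swap s c 1"] exI[of _ "half_swap s c (- 1)"]) auto
qed

end
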